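(* Let $(A,S)$ be an Artin-Tits system with $A$ of spherical type, and let $\beta\in A$ be conjugate in $A$ to a power $t^k$ ($k\in\mathbb{Z}$) of some element $t\in S$. Then there exist $b\in A^+$, $s\in S$ and $j\in\mathbb{Z}$ such that the orthogonal splitting of $\beta$ is $\beta = b s^{j} b^{-1}$; that is, the orthogonal splitting of $\beta$ is $(bs^{j})\,b^{-1}$ if $j\ge 0$, and it is $b\,(bs^{-j})^{-1}$ if $j<0$.
   Context: A Coxeter matrix over a finite set $S$ is a symmetric matrix $M=(m_{s,t})_{s,t\in S}$ with $m_{s,s}=1$ and $m_{s,t}\in\{2,3,4,\dots\}\cup\{\infty\}$ for $s\ne t$. The associated Artin-Tits system is the pair $(A,S)$, where $A$ is the group with generating set $S$ and relations $\underbrace{sts\cdots}_{m_{s,t}\text{ letters}}=\underbrace{tst\cdots}_{m_{s,t}\text{ letters}}$ for all distinct $s,t\in S$ with $m_{s,t}\neq\infty$. The group $A$ is of spherical type if the Coxeter group obtained by adding the relations $s^2=1$ ($s\in S$) is finite. $A^+$ denotes the submonoid of $A$ generated by $S$ (it has the same presentation, as a monoid). For $\alpha,\gamma\in A^+$, $\alpha$ right-divides $\gamma$ if $\gamma=\delta\alpha$ for some $\delta\in A^+$. In spherical type any two elements $a,b\in A^+$ have a greatest common divisor for right-divisibility, denoted $a\land_\succ b$. Orthogonal splitting: when $A$ is of spherical type, for every $\beta\in A$ there is a unique pair $(a,b)$ of elements of $A^+$ with $\beta=ab^{-1}$ and $a\land_\succ b=1$; the decomposition $\beta=ab^{-1}$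 is called the (right) orthogonal splitting of $\beta$. *)

theory Defs
  imports "HOL-Algebra.Group" "HOL-Library.Extended_Nat"
begin

section \<open>Groups given by generators and relations\<close>

text \<open>A signed letter \<open>(s, True)\<close> stands for the generator \<open>s\<close>, and \<open>(s, False)\<close> for its inverse.
  A relation is a pair of positive words.\<close>

definition signed_words :: "'a set \<Rightarrow> ('a \<times> bool) list set" where
  "signed_words S = lists (S \<times> UNIV)"

definition pos_word :: "'a list \<Rightarrow> ('a \<times> bool) list" where
  "pos_word w = map (\<lambda>s. (s, True)) w"

inductive_set pres_cong ::
    "'a set \<Rightarrow> ('a list \<times> 'a list) set \<Rightarrow> (('a \<times> bool) list \<times> ('a \<times> bool) list) set"
  for S :: "'a set" and R :: "('a list \<times> 'a list) set" where
  refl: "w \<in> signed_words S \<Longrightarrow> (w, w) \<in> pres_cong S R"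
| sym: "(u, v) \<in> pres_cong S R \<Longrightarrow> (v, u) \<in> pres_cong S R"
| trans: "(u, v) \<in> pres_cong S R \<Longrightarrow> (v, w) \<in> pres_cong S R \<Longrightarrow> (u, w) \<in> pres_cong S R"
| cancel: "u \<in> signed_words S \<Longrightarrow> v \<in> signed_words S \<Longrightarrow> s \<in> S \<Longrightarrow>
    (u @ [(s, e), (s, \<not> e)] @ v, u @ v) \<in> pres_cong S R"
| rel: "u \<in> signed_words S \<Longrightarrow> v \<in> signed_words S \<Longrightarrow> (l, r) \<in> R \<Longrightarrow>
    (u @ pos_word l @ v, u @ pos_word r @ v) \<in> pres_cong S R"

definition pres_group :: "'a set \<Rightarrow> ('a list \<times> 'a list) set \<Rightarrow> ('a \<times> bool) list set monoid" where
  "pres_group S R =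
    \<lparr>carrier = signed_words S // pres_cong S R,
     mult = (\<lambda>U V. \<Union>x\<in>U. \<Union>y\<in>V. pres_cong S R `` {x @ y}),
     one = pres_cong S R `` {[]}\<rparr>"

definition pres_gen :: "'a set \<Rightarrow> ('a list \<times> 'a list) set \<Rightarrow> 'a \<Rightarrow> ('a \<times> bool) list set" where
  "pres_gen S R s = pres_cong S R `` {[(s, True)]}"

lemma signed_words_append [simp]:
  "u @ v \<in> signed_words S \<longleftrightarrow> u \<in> signed_words S \<and> v \<in> signed_words S"
  by (auto simp: signed_words_def)

lemma signed_words_Nil [simp]: "[] \<in> signed_words S"
  by (simp add: signed_words_def)

lemma signed_words_Cons [simp]:
  "x # w \<in> signed_words S \<longleftrightarrow> fst x \<in> S \<and> w \<in> signed_words S"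
  by (cases x) (auto simp: signed_words_def)

lemma pos_word_signed: "w \<in> lists S \<Longrightarrow> pos_word w \<in> signed_words S"
  by (auto simp: pos_word_def signed_words_def in_lists_conv_set)

lemma pres_cong_signed:
  assumes "R \<subseteq> lists S \<times> lists S" and "(u, v) \<in> pres_cong S R"
  shows "u \<in> signed_words S \<and> v \<in> signed_words S"
  using assms(2)
proof (induction rule: pres_cong.induct)
  case (rel u v l r)
  then have "pos_word l \<in> signed_words S" "pos_word r \<in> signed_words S"
    using assms(1) by (auto intro: pos_word_signed)
  then show ?case using rel by simp
qed auto

lemma pres_cong_append_left:
  assumes "(u, v) \<in> pres_cong S R" and "w \<in> signed_words S"
  shows "(w @ u, w @ v) \<in> pres_cong S R"
  using assms(1)
proof (induction rule: pres_cong.induct)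
  case (cancel u v s e)
  then show ?case using pres_cong.cancel[of "w @ u" S v s e R] assms(2) by simp
next
  case (rel u v l r)
  then show ?case using pres_cong.rel[of "w @ u" S v l r R] assms(2) by simp
next
  case (trans u v x)
  then show ?case using pres_cong.trans by blast
qed (use assms(2) in \<open>auto intro: pres_cong.refl pres_cong.sym\<close>)

lemma pres_cong_append_right:
  assumes "(u, v) \<in> pres_cong S R" and "w \<in> signed_words S"
  shows "(u @ w, v @ w) \<in> pres_cong S R"
  using assms(1)
proof (induction rule: pres_cong.induct)
  case (cancel u v s e)
  then show ?case using pres_cong.cancel[of u S "v @ w" s e R] assms(2) by simp
next
  case (rel u v l r)
  then show ?case using pres_cong.rel[of u S "v @ w" l r R] assms(2) by simp
next
  case (trans u v x)
  then show ?case using pres_cong.trans by blast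
qed (use assms(2) in \<open>auto intro: pres_cong.refl pres_cong.sym\<close>)

lemma equiv_pres_cong:
  assumes "R \<subseteq> lists S \<times> lists S"
  shows "equiv (signed_words S) (pres_cong S R)"
proof (rule equivI)
  show "pres_cong S R \<subseteq> signed_words S \<times> signed_words S"
    using pres_cong_signed[OF assms] by auto
  show "refl_on (signed_words S) (pres_cong S R)"
    by (auto simp: refl_on_def intro: pres_cong.refl)
  show "sym (pres_cong S R)" by (rule symI) (rule pres_cong.sym)
  show "trans (pres_cong S R)" by (rule transI) (rule pres_cong.trans)
qed

lemma pres_group_mult_class:
  assumes R: "R \<subseteq> lists S \<times> lists S" and u: "u \<in> signed_words S" and v: "v \<in> signed_words S"
  shows "pres_cong S R `` {u} \<otimes>\<^bsub>pres_group S R\<^esub> pres_cong S R `` {v} = pres_cong S R `` {u @ v}"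
proof -
  note eq = equiv_pres_cong[OF R]
  have "pres_cong S R `` {x @ y} = pres_cong S R `` {u @ v}"
    if "(u, x) \<in> pres_cong S R" "(v, y) \<in> pres_cong S R" for x y
  proof -
    have "(u @ v, x @ v) \<in> pres_cong S R"
      using pres_cong_append_right that(1) v by blast
    moreover have "(x @ v, x @ y) \<in> pres_cong S R"
      using pres_cong_append_left that pres_cong_signed[OF R] by blast
    ultimately have "(u @ v, x @ y) \<in> pres_cong S R" by (rule pres_cong.trans)
    then show ?thesis using equiv_class_eq[OF eq] by metis
  qed
  moreover have "(u, u) \<in> pres_cong S R" "(v, v) \<in> pres_cong S R"
    using u v by (auto intro: pres_cong.refl)
  ultimately have "(\<Union>x\<in>pres_cong S R `` {u}. \<Union>y\<in>pres_cong S R `` {v}. pres_cong S R `` {x @ y}) =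
      pres_cong S R `` {u @ v}"
    by blast
  then show ?thesis by (simp add: pres_group_def)
qed

lemma pres_cong_cancel_inverse:
  assumes "w \<in> signed_words S"
  shows "(rev (map (\<lambda>(s, e). (s, \<not> e)) w) @ w, []) \<in> pres_cong S R"
  using assms
proof (induction w)
  case Nil
  then show ?case by (auto intro: pres_cong.refl)
next
  case (Cons x w)
  obtain s e where x: "x = (s, e)" by fastforce
  let ?i = "rev (map (\<lambda>(s, e). (s, \<not> e)) w)"
  have "?i \<in> signed_words S"
    using Cons.prems by (auto simp: signed_words_def in_lists_conv_set)
  then have "(?i @ [(s, \<not> e), (s, \<not> \<not> e)] @ w, ?i @ w) \<in> pres_cong S R"
    using Cons.prems x by (intro pres_cong.cancel) auto
  moreover have "(?i @ w, []) \<in> pres_cong S R" using Cons by simp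
  ultimately have "(?i @ [(s, \<not> e), (s, \<not> \<not> e)] @ w, []) \<in> pres_cong S R"
    by (rule pres_cong.trans)
  then show ?case using x by simp
qed

lemma group_pres_group:
  assumes R: "R \<subseteq> lists S \<times> lists S"
  shows "group (pres_group S R)"
proof -
  have car: "carrier (pres_group S R) = (\<lambda>w. pres_cong S R `` {w}) ` signed_words S"
    by (auto simp: pres_group_def quotient_def)
  have one: "\<one>\<^bsub>pres_group S R\<^esub> = pres_cong S R `` {[]}" by (simp add: pres_group_def)
  note mult = pres_group_mult_class[OF R]
  show ?thesis
  proof (rule groupI)
    fix u assume "u \<in> carrier (pres_group S R)"
    then obtain w where w: "w \<in> signed_words S" "u = pres_cong S R `` {w}" using car by auto
    let ?i = "rev (map (\<lambda>(s, e). (s, \<not> e)) w)"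
    have i: "?i \<in> signed_words S" 
      using w by (auto simp: signed_words_def in_lists_conv_set)
    have "pres_cong S R `` {?i @ w} = pres_cong S R `` {[]}"
      using equiv_class_eq[OF equiv_pres_cong[OF R] pres_cong_cancel_inverse[OF w(1)]] .
    then show "\<exists>v\<in>carrier (pres_group S R). v \<otimes>\<^bsub>pres_group S R\<^esub> u = \<one>\<^bsub>pres_group S R\<^esub>"
      unfolding car one using i mult[OF i w(1)] w(2) by auto
  qed (auto simp: car one mult)
qed


section \<open>Artin-Tits systems\<close>

definition coxeter_matrix :: "'a set \<Rightarrow> ('a \<Rightarrow> 'a \<Rightarrow> enat) \<Rightarrow> bool" where
  "coxeter_matrix S m \<longleftrightarrow> finite S \<and>
     (\<forall>s\<in>S. m s s = 1) \<and>
     (\<forall>s\<in>S. \<forall>t\<in>S. m s t = m t s) \<and>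
     (\<forall>s\<in>S. \<forall>t\<in>S. s \<noteq> t \<longrightarrow> 2 \<le> m s t)"

text \<open>\<open>alt_word n s t\<close> is the alternating word \<open>s t s \<dots>\<close> with \<open>n\<close> letters.\<close>

fun alt_word :: "nat \<Rightarrow> 'a \<Rightarrow> 'a \<Rightarrow> 'a list" where
  "alt_word 0 s t = []"
| "alt_word (Suc n) s t = s # alt_word n t s"

definition braid_rels :: "'a set \<Rightarrow> ('a \<Rightarrow> 'a \<Rightarrow> enat) \<Rightarrow> ('a list \<times> 'a list) set" where
  "braid_rels S m =
     {(alt_word n s t, alt_word n t s) | n s t. s \<in> S \<and> t \<in> S \<and> s \<noteq> t \<and> m s t = enat n}"

definition artin_group :: "'a set \<Rightarrow> ('a \<Rightarrow> 'a \<Rightarrow> enat) \<Rightarrow> ('a \<times> bool) list set monoid" where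
  "artin_group S m = pres_group S (braid_rels S m)"

definition artin_gen :: "'a set \<Rightarrow> ('a \<Rightarrow> 'a \<Rightarrow> enat) \<Rightarrow> 'a \<Rightarrow> ('a \<times> bool) list set" where
  "artin_gen S m s = pres_gen S (braid_rels S m) s"

definition coxeter_group :: "'a set \<Rightarrow> ('a \<Rightarrow> 'a \<Rightarrow> enat) \<Rightarrow> ('a \<times> bool) list set monoid" where
  "coxeter_group S m = pres_group S (braid_rels S m \<union> {([s, s], []) | s. s \<in> S})"

definition spherical_type :: "'a set \<Rightarrow> ('a \<Rightarrow> 'a \<Rightarrow> enat) \<Rightarrow> bool" where
  "spherical_type S m \<longleftrightarrow> finite (carrier (coxeter_group S m))"

lemma alt_word_in_lists: "s \<in> S \<Longrightarrow> t \<in> S \<Longrightarrow> alt_word n s t \<in> lists S"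
  by (induction n s t rule: alt_word.induct) auto

lemma group_artin_group: "group (artin_group S m)"
  unfolding artin_group_def
  by (rule group_pres_group) (auto simp: braid_rels_def dest: alt_word_in_lists)

lemma group_coxeter_group: "group (coxeter_group S m)"
  unfolding coxeter_group_def
  by (rule group_pres_group) (auto simp: braid_rels_def dest: alt_word_in_lists)


section \<open>Orthogonal splittings\<close>

inductive_set artin_monoid :: "'a set \<Rightarrow> ('a \<Rightarrow> 'a \<Rightarrow> enat) \<Rightarrow> ('a \<times> bool) list set set"
  for S :: "'a set" and m :: "'a \<Rightarrow> 'a \<Rightarrow> enat" where
  one: "\<one>\<^bsub>artin_group S m\<^esub> \<in> artin_monoid S m"
| gen: "s \<in> S \<Longrightarrow> artin_gen S m s \<in> artin_monoid S m"
| mult: "a \<in> artin_monoid S m \<Longrightarrow> b \<in> artin_monoid S m \<Longrightarrow>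
    a \<otimes>\<^bsub>artin_group S m\<^esub> b \<in> artin_monoid S m"

definition right_divides ::
    "'a set \<Rightarrow> ('a \<Rightarrow> 'a \<Rightarrow> enat) \<Rightarrow> ('a \<times> bool) list set \<Rightarrow> ('a \<times> bool) list set \<Rightarrow> bool" where
  "right_divides S m a c \<longleftrightarrow> (\<exists>d\<in>artin_monoid S m. c = d \<otimes>\<^bsub>artin_group S m\<^esub> a)"

definition is_right_gcd ::
    "'a set \<Rightarrow> ('a \<Rightarrow> 'a \<Rightarrow> enat) \<Rightarrow> ('a \<times> bool) list set \<Rightarrow> ('a \<times> bool) list set \<Rightarrow>
      ('a \<times> bool) list set \<Rightarrow> bool" where
  "is_right_gcd S m a b d \<longleftrightarrow>
     d \<in> artin_monoid S m \<and> right_divides S m d a \<and> right_divides S m d b \<and>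
     (\<forall>c\<in>artin_monoid S m. right_divides S m c a \<and> right_divides S m c b \<longrightarrow> right_divides S m c d)"

text \<open>In spherical type each \<open>\<beta>\<close> has exactly one orthogonal splitting, so it is rendered as a
  relation between \<open>\<beta>\<close> and the pair \<open>(a, b)\<close>.\<close>

definition orthogonal_splitting ::
    "'a set \<Rightarrow> ('a \<Rightarrow> 'a \<Rightarrow> enat) \<Rightarrow> ('a \<times> bool) list set \<Rightarrow>
      ('a \<times> bool) list set \<times> ('a \<times> bool) list set \<Rightarrow> bool" where
  "orthogonal_splitting S m \<beta> = (\<lambda>(a, b).
     a \<in> artin_monoid S m \<and> b \<in> artin_monoid S m \<and>
     \<beta> = a \<otimes>\<^bsub>artin_group S m\<^esub> inv\<^bsub>artin_group S m\<^esub> b \<and>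
     is_right_gcd S m a b \<one>\<^bsub>artin_group S m\<^esub>)"

end

theory Submission
  imports Defs Complex_Main
begin

text \<open>
  Choose a shortest positive \<open>b\<close> with \<open>\<beta> = b s\<^sup>n b\<^sup>-\<^sup>1\<close>, where \<open>n > 0\<close>. Suppose that a generator \<open>u\<close>
  right-divides both \<open>b\<close> and \<open>b s\<^sup>n\<close>. If \<open>u \<noteq> s\<close>, then \<open>b s\<^sup>n\<close> is a left multiple of the lcm \<open>X s\<close> of \<open>s\<close>
  and \<open>u\<close>; as \<open>X\<close> ends with \<open>u\<close>, the powers of \<open>s\<close> can be stripped one by one, and \<open>b = e X\<close>. The
  same holds with \<open>X = s\<close> if \<open>u = s\<close>. Now \<open>X s = r X\<close> for a generator \<open>r\<close>, hence \<open>\<beta> = e r\<^sup>n e\<^sup>-\<^sup>1\<close>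
  with \<open>e\<close> shorter than \<open>b\<close>, a contradiction.

  This needs lcms of generators in \<open>A\<^sup>+\<close>. They exist in the monoid of positive braids by Garside's
  induction, where the case of three generators is settled by a confluence argument among reduced words
  of the Coxeter group; the latter are controlled by the geometric representation. In spherical type the
  longest element squared is a central common multiple of the generators, so positive braids embed in
  \<open>A\<close> and every conjugation can be done by a positive element.
\<close>

section \<open>Thue congruences\<close>

text \<open>A step may use a relation in either direction, so the reflexive transitive closure is
  already a congruence. In contrast with \<open>pres_cong\<close> it never leaves positive words, so
  it presents the monoid.\<close>

definition rewr :: "('a list \<times> 'a list) set \<Rightarrow> 'a list \<Rightarrow> 'a list \<Rightarrow> bool" where
  "rewr R u v \<longleftrightarrow> (\<exists>p q l r. ((l, r) \<in> R \<or> (r, l) \<in> R) \<and> u = p @ l @ q \<and> v = p @ r @ q)"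

definition thue :: "('a list \<times> 'a list) set \<Rightarrow> 'a list \<Rightarrow> 'a list \<Rightarrow> bool" where
  "thue R = (rewr R)\<^sup>*\<^sup>*"

lemma thue_refl [simp, intro]: "thue R u u"
  by (simp add: thue_def)

lemma thue_trans [trans]: "thue R u v \<Longrightarrow> thue R v w \<Longrightarrow> thue R u w"
  unfolding thue_def by (rule rtranclp_trans)

lemma thue_sym: "thue R u v \<Longrightarrow> thue R v u"
proof -
  have "symp (rewr R)" unfolding symp_def rewr_def by blast
  then show "thue R u v \<Longrightarrow> thue R v u"
    unfolding thue_def by (metis sympD symp_rtranclp)
qed

lemma thue_rel: "(l, r) \<in> R \<Longrightarrow> thue R l r"
  unfolding thue_def rewr_def by (rule r_into_rtranclp) (metis append_Nil append_Nil2)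

lemma thue_context:
  assumes "thue R u v"
  shows "thue R (p @ u @ q) (p @ v @ q)"
  using assms unfolding thue_def
proof (induction rule: rtranclp_induct)
  case (step v w)
  have "rewr R (p @ v @ q) (p @ w @ q)"
    using step(2) unfolding rewr_def by (metis append.assoc)
  with step show ?case by simp
qed simp

lemma thue_append: "thue R u u' \<Longrightarrow> thue R v v' \<Longrightarrow> thue R (u @ v) (u' @ v')"
  using thue_context[of R u u' "[]" v] thue_context[of R v v' u' "[]"] thue_trans by auto

lemma thue_Cons: "thue R u v \<Longrightarrow> thue R (s # u) (s # v)"
  using thue_append[of R "[s]" "[s]"] by simp

text \<open>Alphabet, length, parity of the length and the action on roots are all carried along
  congruences by this principle.\<close>

lemma thue_invariant:
  assumes "thue R u v"
    and "\<And>p q l r. (l, r) \<in> R \<Longrightarrow> f (p @ l @ q) = f (p @ r @ q)"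
  shows "f u = f v"
  using assms(1) unfolding thue_def
proof (induction rule: rtranclp_induct)
  case (step v w)
  then show ?case using assms(2) unfolding rewr_def by metis
qed simp

lemma thue_rev:
  assumes "thue R u v" and R: "\<And>l r. (l, r) \<in> R \<Longrightarrow> thue R (rev l) (rev r)"
  shows "thue R (rev u) (rev v)"
  using assms(1) unfolding thue_def[of R]
proof (induction rule: rtranclp_induct)
  case (step v w)
  then obtain p q l r where 1: "(l, r) \<in> R \<or> (r, l) \<in> R" "v = p @ l @ q" "w = p @ r @ q"
    unfolding rewr_def by blast
  have "thue R (rev l) (rev r)" using 1(1) R thue_sym by blast
  then have "thue R (rev v) (rev w)" unfolding 1 by (simp add: thue_context)
  with step(3) show ?case unfolding thue_def by simp
qed simp

lemma thue_mono:
  assumes "thue R u v" "R \<subseteq> R'" shows "thue R' u v"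
proof -
  have "rewr R \<le> rewr R'" using assms(2) unfolding rewr_def by blast
  then show ?thesis using assms(1) rtranclp_mono unfolding thue_def by blast
qed

lemma thue_lists:
  assumes "thue R u v" "R \<subseteq> lists S \<times> lists S"
  shows "u \<in> lists S \<longleftrightarrow> v \<in> lists S"
proof (rule thue_invariant[OF assms(1), where f = "\<lambda>w. w \<in> lists S"])
  fix p q l r :: "'a list" assume "(l, r) \<in> R"
  then have "l \<in> lists S" "r \<in> lists S" using assms(2) by auto
  then show "(p @ l @ q \<in> lists S) = (p @ r @ q \<in> lists S)" by auto
qed

section \<open>From Thue congruences to presented groups\<close>

lemma pos_word_append [simp]: "pos_word (u @ v) = pos_word u @ pos_word v"
  by (simp add: pos_word_def)

lemma thue_imp_pres_cong:
  assumes "thue R u v" and R: "R \<subseteq> lists S \<times> lists S" and "u \<in> lists S"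
  shows "(pos_word u, pos_word v) \<in> pres_cong S R"
  using assms(1) unfolding thue_def
proof (induction rule: rtranclp_induct)
  case base
  show ?case using assms(3) by (intro pres_cong.refl pos_word_signed)
next
  case (step v w)
  then obtain p q l r where 1: "(l, r) \<in> R \<or> (r, l) \<in> R" "v = p @ l @ q" "w = p @ r @ q"
    unfolding rewr_def by blast
  have "v \<in> lists S" using thue_lists[OF _ R] step(1) assms(3) unfolding thue_def by blast
  then have "p \<in> lists S" "q \<in> lists S" using 1 by auto
  then have *: "pos_word p \<in> signed_words S" "pos_word q \<in> signed_words S"
    by (auto intro: pos_word_signed)
  have "(pos_word v, pos_word w) \<in> pres_cong S R"
    using 1(1) pres_cong.rel[OF *, of l r R] pres_cong.sym[OF pres_cong.rel[OF *, of r l R]]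
    unfolding 1(2,3) by auto
  with step show ?case using pres_cong.trans by blast
qed

section \<open>Alternating words\<close>

lemma length_alt_word [simp]: "length (alt_word n s t) = n"
  by (induction n s t rule: alt_word.induct) auto

lemma alt_word_add:
  "alt_word (k + j) s t = alt_word k s t @ (if even k then alt_word j s t else alt_word j t s)"
  by (induction k s t rule: alt_word.induct) auto

lemma alt_word_Suc_right: "alt_word (Suc k) s t = alt_word k s t @ [if even k then s else t]"
  using alt_word_add[of k 1 s t] by simp

lemma rev_alt_word: "rev (alt_word k s t) = (if even k then alt_word k t s else alt_word k s t)"
proof (induction k)
  case (Suc k)
  have "rev (alt_word (Suc k) s t) = (if even k then s else t) # rev (alt_word k s t)"
    by (subst alt_word_Suc_right) simp
  then show ?case using Suc by simp
qed simp

section \<open>The geometric representation of a Coxeter group\<close>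

definition simple_root :: "'a \<Rightarrow> 'a \<Rightarrow> real" where
  "simple_root s = (\<lambda>x. if x = s then 1 else 0)"

locale coxeter_system =
  fixes S :: "'a set" and m :: "'a \<Rightarrow> 'a \<Rightarrow> enat"
  assumes coxeter_matrix: "coxeter_matrix S m"
begin

abbreviation cox_rels :: "('a list \<times> 'a list) set" where
  "cox_rels \<equiv> braid_rels S m \<union> {([s, s], []) | s. s \<in> S}"

abbreviation braid_eq :: "'a list \<Rightarrow> 'a list \<Rightarrow> bool" (infix "\<sim>" 50) where
  "u \<sim> v \<equiv> thue (braid_rels S m) u v"

abbreviation cox_eq :: "'a list \<Rightarrow> 'a list \<Rightarrow> bool" (infix "\<approx>" 50) where
  "u \<approx> v \<equiv> thue cox_rels u v"

lemma finite_S: "finite S"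
  and m_refl: "s \<in> S \<Longrightarrow> m s s = 1"
  and m_sym: "s \<in> S \<Longrightarrow> t \<in> S \<Longrightarrow> m s t = m t s"
  and m_ge_2: "s \<in> S \<Longrightarrow> t \<in> S \<Longrightarrow> s \<noteq> t \<Longrightarrow> 2 \<le> m s t"
  using coxeter_matrix unfolding coxeter_matrix_def by blast+

lemma m_enat_ge_2: "s \<in> S \<Longrightarrow> t \<in> S \<Longrightarrow> s \<noteq> t \<Longrightarrow> m s t = enat n \<Longrightarrow> 2 \<le> n"
  using m_ge_2[of s t] by (simp add: numeral_eq_enat)

lemma m_enat_Suc:
  assumes "s \<in> S" "t \<in> S" "m s t = enat n"
  obtains k where "n = Suc k"
  using m_enat_ge_2[OF assms(1,2) _ assms(3)] m_refl[OF assms(1)] assms(3)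
  by (cases n; cases "s = t") (auto simp: one_enat_def)

lemma braid_rels_lists: "braid_rels S m \<subseteq> lists S \<times> lists S"
  by (auto simp: braid_rels_def dest: alt_word_in_lists)

lemma cox_rels_lists: "cox_rels \<subseteq> lists S \<times> lists S"
  using braid_rels_lists by auto

lemma braid_eq_lists: "u \<sim> v \<Longrightarrow> u \<in> lists S \<longleftrightarrow> v \<in> lists S"
  using thue_lists[OF _ braid_rels_lists] .

lemma cox_eq_lists: "u \<approx> v \<Longrightarrow> u \<in> lists S \<longleftrightarrow> v \<in> lists S"
  using thue_lists[OF _ cox_rels_lists] .

lemma braid_imp_cox: "u \<sim> v \<Longrightarrow> u \<approx> v"
  by (erule thue_mono) simp

lemma braid_eq_length: "u \<sim> v \<Longrightarrow> length u = length v"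
  by (erule thue_invariant) (auto simp: braid_rels_def)

lemma braid_rel: "s \<in> S \<Longrightarrow> t \<in> S \<Longrightarrow> m s t = enat n \<Longrightarrow> alt_word n s t \<sim> alt_word n t s"
  by (cases "s = t") (auto intro!: thue_rel simp: braid_rels_def)

lemma cox_square: "s \<in> S \<Longrightarrow> s # s # w \<approx> w"
  using thue_append[OF thue_rel[of "[s,s]" "[]" cox_rels] thue_refl] by simp

lemma braid_eq_rev: "u \<sim> v \<Longrightarrow> rev u \<sim> rev v"
proof (erule thue_rev)
  fix l r assume "(l, r) \<in> braid_rels S m"
  then obtain n s t where "s \<in> S" "t \<in> S" "m s t = enat n" "l = alt_word n s t" "r = alt_word n t s"
    unfolding braid_rels_def by blast
  then show "rev l \<sim> rev r"
    using braid_rel[of s t n] braid_rel[of t s n] by (simp add: rev_alt_word m_sym)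
qed

lemma cox_eq_rev: "u \<approx> v \<Longrightarrow> rev u \<approx> rev v"
proof (erule thue_rev)
  fix l r assume "(l, r) \<in> cox_rels"
  then show "rev l \<approx> rev r"
  proof
    assume "(l, r) \<in> braid_rels S m"
    then show ?thesis using braid_imp_cox braid_eq_rev thue_rel by blast
  qed (auto intro: thue_rel)
qed

text \<open>The Gram matrix of the Tits form; the value for \<infinity> is the limit of
  \<open>- cos (pi / n)\<close>.\<close>

definition bil :: "'a \<Rightarrow> 'a \<Rightarrow> real" where
  "bil s t = (case m s t of \<infinity> \<Rightarrow> - 1 | enat n \<Rightarrow> - cos (pi / n))"

definition reflection :: "'a \<Rightarrow> ('a \<Rightarrow> real) \<Rightarrow> 'a \<Rightarrow> real" where
  "reflection s v = v(s := v s - 2 * (\<Sum>t\<in>S. bil s t * v t))"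

text \<open>The first letter acts first, so a word acts as the product of its reversal.\<close>

definition wact :: "'a list \<Rightarrow> ('a \<Rightarrow> real) \<Rightarrow> 'a \<Rightarrow> real" where
  "wact w = fold reflection w"

lemma wact_simps [simp]:
  "wact [] v = v" "wact (s # w) v = wact w (reflection s v)" "wact (u @ w) v = wact w (wact u v)"
  by (simp_all add: wact_def)

lemma bil_sym: "s \<in> S \<Longrightarrow> t \<in> S \<Longrightarrow> bil s t = bil t s"
  by (simp add: bil_def m_sym)

lemma bil_refl: "s \<in> S \<Longrightarrow> bil s s = 1"
  by (simp add: bil_def m_refl one_enat_def)

lemma reflection_linear: "reflection s (\<lambda>x. a * v x + b * u x) = (\<lambda>x. a * reflection s v x + b * reflection s u x)"
proof
  fix x
  have "(\<Sum>t\<in>S. bil s t * (a * v t + b * u t)) =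
      a * (\<Sum>t\<in>S. bil s t * v t) + b * (\<Sum>t\<in>S. bil s t * u t)"
    by (simp add: sum.distrib sum_distrib_left algebra_simps)
  then show "reflection s (\<lambda>x. a * v x + b * u x) x = a * reflection s v x + b * reflection s u x"
    by (simp add: reflection_def algebra_simps)
qed

lemma wact_linear: "wact w (\<lambda>x. a * v x + b * u x) = (\<lambda>x. a * wact w v x + b * wact w u x)"
  by (induction w arbitrary: v u) (simp_all add: reflection_linear)

lemma wact_minus: "wact w (\<lambda>x. - v x) = (\<lambda>x. - wact w v x)"
  using wact_linear[of w "- 1" v 0 v] by simp

lemma sum_bil_simple_root: "t \<in> S \<Longrightarrow> (\<Sum>r\<in>S. bil s r * simple_root t r) = bil s t"
  by (simp add: simple_root_def finite_S if_distrib cong: if_cong)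

lemma reflection_root: "t \<in> S \<Longrightarrow> reflection s (simple_root t) = (\<lambda>x. 1 * simple_root t x + (- 2 * bil s t) * simple_root s x)"
  unfolding reflection_def sum_bil_simple_root by (auto simp: simple_root_def)

lemma reflection_root_same: "s \<in> S \<Longrightarrow> reflection s (simple_root s) = (\<lambda>x. - simple_root s x)"
  by (simp add: reflection_root bil_refl)

lemma reflection_involution:
  assumes "s \<in> S" shows "reflection s (reflection s v) = v"
proof -
  have *: "reflection s v = (\<lambda>x. 1 * v x + (- 2 * (\<Sum>t\<in>S. bil s t * v t)) * simple_root s x)" for v
    by (auto simp: reflection_def simple_root_def)
  show ?thesis
    by (subst (2) *, subst reflection_linear, subst (1) *, simp add: reflection_root_same[OF assms])
qed

text \<open>These are the values at \<open>2 cos (\<pi> / m s t)\<close> of the Chebyshev polynomials of the second kind.\<close>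

definition qn :: "'a \<Rightarrow> 'a \<Rightarrow> nat \<Rightarrow> real" where
  "qn s t k = (case m s t of \<infinity> \<Rightarrow> real k | enat n \<Rightarrow> sin (k * (pi / n)) / sin (pi / n))"

lemma sin_pi_div_pos: "2 \<le> n \<Longrightarrow> 0 < sin (pi / real n)"
  by (intro sin_gt_zero) (auto simp: field_simps)

lemma qn_sym: "s \<in> S \<Longrightarrow> t \<in> S \<Longrightarrow> qn s t = qn t s"
  by (simp add: qn_def m_sym fun_eq_iff)

lemma qn_0 [simp]: "qn s t 0 = 0"
  by (simp add: qn_def split: enat.split)

lemma qn_1:
  assumes "s \<in> S" "t \<in> S" "s \<noteq> t" shows "qn s t (Suc 0) = 1"
proof (cases "m s t")
  case (enat n)
  then have "sin (pi / real n) > 0" using m_enat_ge_2[OF assms] sin_pi_div_pos by blast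
  then show ?thesis using enat by (simp add: qn_def)
qed (simp add: qn_def)

text \<open>With x = pi / n this is sin((k+2)x) + sin(kx) = 2 sin((k+1)x) cos x; for
  \<open>m s t\<close> infinite it is k + 2 = 2(k + 1) - k.\<close>

lemma qn_rec: "qn s t (Suc (Suc k)) = - 2 * bil s t * qn s t (Suc k) - qn s t k"
proof (cases "m s t")
  case (enat n)
  define x where "x = pi / real n"
  have "sin (real (Suc (Suc k)) * x) + sin (real k * x) = 2 * sin (real (Suc k) * x) * cos x"
    using sin_plus_sin[of "real (Suc (Suc k)) * x" "real k * x"]
    by (simp add: algebra_simps add_divide_distrib)
  then have "sin (real (Suc (Suc k)) * x) = 2 * sin (real (Suc k) * x) * cos x - sin (real k * x)"
    by linarith
  then show ?thesis using enat
    by (simp only: qn_def bil_def enat.case x_def[symmetric]) (simp add: diff_divide_distrib)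
qed (simp add: qn_def bil_def)

text \<open>Up to the order of the braid relation the angle k pi / n stays in [0, pi]. This sign is
  what all length estimates in rank two rest on.\<close>

lemma qn_nonneg:
  assumes "s \<in> S" "t \<in> S" "s \<noteq> t" "enat k \<le> m s t"
  shows "0 \<le> qn s t k"
proof (cases "m s t")
  case (enat n)
  then have n: "2 \<le> n" using m_enat_ge_2[OF assms(1-3)] by blast
  have "0 \<le> sin (real k * (pi / real n))"
    using assms(4) enat n by (intro sin_ge_zero) (auto simp: field_simps)
  then show ?thesis using enat sin_pi_div_pos[OF n] by (simp add: qn_def)
qed (simp add: qn_def)

text \<open>Peeling off the first letter expresses the image through the words that are one and two
  letters shorter, with the coefficients of \<open>qn_rec\<close>; hence the two-step
  induction.\<close>

lemma wact_alt_word_root: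
  assumes "s \<in> S" "t \<in> S" "s \<noteq> t"
  shows "wact (alt_word k t s) (simple_root s) =
    (\<lambda>x. qn s t (Suc k) * simple_root (if even k then s else t) x + qn s t k * simple_root (if even k then t else s) x)"
  using assms
proof (induction k arbitrary: s t rule: induct_nat_012)
  case 0
  then show ?case by (simp add: qn_1)
next
  case 1
  then show ?case by (simp add: qn_1 qn_rec reflection_root bil_sym fun_eq_iff)
next
  case (ge2 k)
  have "wact (alt_word (Suc (Suc k)) t s) (simple_root s) = wact (alt_word (Suc k) s t) (reflection t (simple_root s))"
    by simp
  also have "\<dots> = (\<lambda>x. 1 * wact (alt_word (Suc k) s t) (simple_root s) x +
      (- 2 * bil s t) * wact (alt_word (Suc k) s t) (simple_root t) x)"
    by (subst reflection_root[OF ge2(3)], subst wact_linear) (simp add: bil_sym ge2)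
  \<comment> \<open>The next letter is \<open>s\<close>, which negates its own root and
    disappears.\<close>
  also have "wact (alt_word (Suc k) s t) (simple_root s) = (\<lambda>x. - wact (alt_word k t s) (simple_root s) x)"
    by (simp add: reflection_root_same ge2 wact_minus)
  finally have *: "wact (alt_word (Suc (Suc k)) t s) (simple_root s) = (\<lambda>x. 1 * - wact (alt_word k t s) (simple_root s) x +
      (- 2 * bil s t) * wact (alt_word (Suc k) s t) (simple_root t) x)" .
  show ?case
    unfolding * ge2(1)[OF ge2(3-5)] ge2(2)[OF ge2(4,3) ge2(5)[symmetric]]
    by (simp add: qn_sym[OF ge2(4,3)] qn_rec fun_eq_iff algebra_simps)
qed

lemma wact_fixed:
  assumes "w \<in> lists {s, t}" "reflection s v = v" "reflection t v = v"
  shows "wact w v = v"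
  using assms by (induction w) auto

text \<open>For finite \<open>m s t\<close> the form is nondegenerate on the plane of the two roots.
  So a vector is a combination of the roots plus a vector orthogonal to both, which both reflections
  fix. On the roots the two sides agree by the explicit formula.\<close>

lemma wact_braid:
  assumes s: "s \<in> S" and t: "t \<in> S" "s \<noteq> t" and m: "m s t = enat n"
  shows "wact (alt_word n s t) v = wact (alt_word n t s) v"
proof -
  have n: "2 \<le> n" using m_enat_ge_2[OF s t m] .
  then obtain k where k: "n = Suc k" by (cases n) auto
  define x where "x = pi / real n"
  have sx: "sin x > 0" unfolding x_def using sin_pi_div_pos[OF n] .
  have nx: "real n * x = pi" using n by (simp add: x_def)
  have "real k * x = pi - x" "real (Suc n) * x = pi + x"
    using nx k by (simp_all add: algebra_simps)
  then have qn: "qn s t n = 0" "qn s t k = 1" "qn s t (Suc n) = - 1"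
    using m sx nx by (simp_all only: qn_def x_def[symmetric] enat.case) simp_all
  \<comment> \<open>The first letter of \<open>alt_word n a b\<close> negates the root of
    \<open>a\<close>, so both sides become instances of the formula, with \<open>n - 1\<close> and
    \<open>n\<close> letters, and only the three values of \<open>qn\<close> above occur.\<close>
  have roots: "wact (alt_word n a b) (simple_root a) = wact (alt_word n b a) (simple_root a)"
    if "a = s \<and> b = t \<or> a = t \<and> b = s" for a b
  proof -
    have ab: "a \<in> S" "b \<in> S" "a \<noteq> b" and qab: "qn a b = qn s t"
      using that s t qn_sym by auto
    have "wact (alt_word n a b) (simple_root a) = (\<lambda>x. - wact (alt_word k b a) (simple_root a) x)"
      using k ab by (simp add: reflection_root_same wact_minus)
    then show ?thesis
      unfolding wact_alt_word_root[OF ab] qab using k qn by (auto simp: fun_eq_iff)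
  qed
  define b where "b = bil s t"
  have b: "1 - b * b \<noteq> 0"
  proof -
    have "b * b = cos x * cos x" using m by (simp add: b_def bil_def x_def)
    moreover have "0 < sin x * sin x" using sx by simp
    ultimately show ?thesis using sin_cos_squared_add3[of x] by linarith
  qed
  define B where "B r v = (\<Sum>u\<in>S. bil r u * v u)" for r and v :: "'a \<Rightarrow> real"
  \<comment> \<open>Cramer's rule for the combination of the two roots that has the same products
    with both roots as \<open>v\<close>; the determinant is the square of sin x.\<close>
  define p q where "p = (B s v - b * B t v) / (1 - b * b)" and "q = (B t v - b * B s v) / (1 - b * b)"
  define w where "w = (\<lambda>x. 1 * v x + (- 1) * (p * simple_root s x + q * simple_root t x))"
  have B: "B r w = B r v - p * bil r s - q * bil r t" for r
  proof -
    have "B r w = (\<Sum>u\<in>S. bil r u * v u - p * (bil r u * simple_root s u) - q * (bil r u * simple_root t u))"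
      unfolding B_def w_def by (intro sum.cong) (auto simp: algebra_simps)
    also have "\<dots> = B r v - p * bil r s - q * bil r t"
      using s t by (simp add: sum_subtractf sum_distrib_left[symmetric] sum_bil_simple_root B_def)
    finally show ?thesis .
  qed
  have "p + b * q = B s v" "b * p + q = B t v"
    using b by (simp_all add: p_def q_def divide_simps) (simp_all add: algebra_simps)
  then have "B s w = 0" "B t w = 0"
    using s t by (simp_all add: B bil_refl bil_sym[of t s] b_def algebra_simps)
  then have fixed: "reflection s w = w" "reflection t w = w" by (simp_all add: reflection_def B_def)
  have alt: "alt_word j s t \<in> lists {s, t}" "alt_word j t s \<in> lists {s, t}" for j
    using alt_word_in_lists[of s "{s,t}" t j] alt_word_in_lists[of t "{s,t}" s j] by auto
  have v: "v = (\<lambda>x. 1 * w x + 1 * (p * simple_root s x + q * simple_root t x))"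
    by (simp add: w_def)
  show ?thesis
    unfolding v wact_linear using roots[of s t] roots[of t s] alt[THEN wact_fixed, OF fixed] by simp
qed

lemma wact_cox_eq: "u \<approx> v \<Longrightarrow> wact u = wact v"
proof (erule thue_invariant)
  fix p q l r assume "(l, r) \<in> cox_rels"
  then have "wact l v = wact r v" for v
  proof
    assume "(l, r) \<in> braid_rels S m"
    then show ?thesis using wact_braid unfolding braid_rels_def by blast
  qed (auto simp: reflection_involution)
  then have "wact l = wact r" by (rule ext)
  then show "wact (p @ l @ q) = wact (p @ r @ q)" by (intro ext) simp
qed

lemma cox_rev_cancel: "w \<in> lists S \<Longrightarrow> rev w @ w \<approx> []"
proof (induction w)
  case (Cons s w)
  then have "rev w @ s # s # w \<approx> rev w @ w" by (intro thue_append cox_square) auto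
  also have "rev w @ w \<approx> []" using Cons by auto
  finally show ?case by simp
qed simp

section \<open>Length and positivity of roots\<close>

definition len :: "'a list \<Rightarrow> nat" where
  "len w = (LEAST n. \<exists>v. v \<approx> w \<and> length v = n)"

abbreviation reduced :: "'a list \<Rightarrow> bool" where
  "reduced w \<equiv> len w = length w"

lemma len_le: "v \<approx> w \<Longrightarrow> len w \<le> length v"
  unfolding len_def by (rule Least_le) blast

lemma len_ex:
  obtains v where "v \<approx> w" "length v = len w"
proof -
  have "\<exists>v. v \<approx> w \<and> length v = len w"
    unfolding len_def by (rule LeastI_ex) blast
  then show thesis using that by blast
qed

lemma len_cong: "u \<approx> v \<Longrightarrow> len u = len v"
proof -
  assume "u \<approx> v"
  then have "x \<approx> u \<longleftrightarrow> x \<approx> v" for x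
    using thue_trans[of _ x u v] thue_trans[OF _ thue_sym, of _ x v u] by blast
  then show ?thesis by (simp add: len_def)
qed

lemma len_le_length: "len w \<le> length w"
  by (rule len_le) simp

lemma len_Nil [simp]: "len [] = 0"
  using len_le_length[of "[]"] by simp

lemma len_append_le: "len (u @ v) \<le> len u + len v"
proof -
  obtain u' where u: "u' \<approx> u" "length u' = len u" using len_ex .
  obtain v' where v: "v' \<approx> v" "length v' = len v" using len_ex .
  show ?thesis using len_le[OF thue_append[OF u(1) v(1)]] u(2) v(2) by simp
qed

lemma len_rev [simp]: "len (rev w) = len w"
proof -
  have *: "len (rev w) \<le> len w" for w
  proof -
    obtain v where v: "v \<approx> w" "length v = len w" using len_ex .
    then show ?thesis using len_le[OF cox_eq_rev[OF v(1)]] by simp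
  qed
  show ?thesis using *[of w] *[of "rev w"] by simp
qed

lemma cox_eq_parity: "u \<approx> v \<Longrightarrow> even (length u) \<longleftrightarrow> even (length v)"
  by (erule thue_invariant) (auto simp: braid_rels_def)

lemma even_len: "even (len w) \<longleftrightarrow> even (length w)"
proof -
  obtain v where "v \<approx> w" "length v = len w" using len_ex .
  then show ?thesis using cox_eq_parity[of v w] by simp
qed

text \<open>A letter changes the length by at most one, in both directions because it is an
  involution, and parity excludes equality.\<close>

lemma len_Cons:
  assumes "s \<in> S" shows "len (s # w) = Suc (len w) \<or> len w = Suc (len (s # w))"
proof -
  have le: "len (s # w) \<le> Suc (len w)" for w
    using len_append_le[of "[s]" w] len_le_length[of "[s]"] by simp
  have "len (s # s # w) = len w" by (intro len_cong cox_square assms)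
  then have "len w \<le> Suc (len (s # w))" using le[of "s # w"] by simp
  moreover have "len (s # w) \<noteq> len w"
  proof
    assume "len (s # w) = len w"
    then have "even (length (s # w)) \<longleftrightarrow> even (length w)" by (simp only: even_len[symmetric])
    then show False by simp
  qed
  ultimately show ?thesis using le[of w] by linarith
qed

lemma reduced_append:
  assumes "reduced (u @ v)" shows "reduced u" "reduced v"
  using assms len_append_le[of u v] len_le_length[of u] len_le_length[of v]
  unfolding length_append by linarith+

lemma reduced_singleton: "s \<in> S \<Longrightarrow> reduced [s]"
  using len_Cons[of s "[]"] by auto

lemma cox_cancel_Cons:
  assumes "s \<in> S" "s # a \<approx> s # b" shows "a \<approx> b"
proof -
  have "a \<approx> s # s # a" by (rule thue_sym[OF cox_square[OF assms(1)]])
  also have "s # s # a \<approx> s # s # b" using thue_Cons[OF assms(2)] .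
  also have "s # s # b \<approx> b" using cox_square[OF assms(1)] .
  finally show ?thesis .
qed

lemma len_square_less: "s \<in> S \<Longrightarrow> len (s # s # w) \<le> len w"
  using len_cong[OF cox_square] by simp

text \<open>Two equal neighbours could be cancelled, which would contradict the additivity of
  lengths.\<close>

lemma alternating_reduced:
  assumes "s \<in> S" "t \<in> S" "z \<in> lists {s, t}" "len (z @ v) = length z + len v"
  shows "\<exists>k. z = alt_word k s t \<or> z = alt_word k t s"
  using assms(3,4)
proof (induction z rule: list.induct)
  case Nil
  show ?case by (rule exI[of _ 0]) simp
next
  case (Cons a z)
  have "a \<in> {s, t}" using Cons.prems(1) by simp
  then have a: "a \<in> S" "a = s \<or> a = t" using assms(1,2) by auto
  have "len (z @ v) = length z + len v"
    using Cons.prems(2) len_append_le[of z v] len_le_length[of z] len_Cons[OF a(1), of "z @ v"]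
    unfolding append_Cons list.size(4) by linarith
  then obtain k where k: "z = alt_word k s t \<or> z = alt_word k t s"
    using Cons by auto
  show ?case
  proof (cases k)
    case 0
    have "a # z = alt_word 1 s t \<or> a # z = alt_word 1 t s" using a(2) k 0 by auto
    then show ?thesis by blast
  next
    case (Suc j)
    then obtain b z' where z: "z = b # z'" using k by fastforce
    have "b \<noteq> a"
    proof
      assume "b = a"
      then have "len ((a # z) @ v) \<le> len (z' @ v)"
        using len_square_less[OF a(1), of "z' @ v"] z by simp
      also have "\<dots> \<le> length z' + len v" using len_append_le[of z' v] len_le_length[of z'] by simp
      finally show False using Cons.prems(2) z by simp
    qed
    then have "a # z = alt_word (Suc k) s t \<or> a # z = alt_word (Suc k) t s"
      using k z a(2) Suc by auto
    then show ?thesis by blast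
  qed
qed

text \<open>The tail \<open>v\<close> is a shortest one among all length-additive factorisations
  with a head in the letters \<open>s\<close> and \<open>t\<close>. Were \<open>s\<close> or
  \<open>t\<close> a descent of \<open>v\<close>, it could be moved to the head.\<close>

lemma dihedral_decomposition:
  assumes st: "s \<in> S" "t \<in> S" and w: "w \<in> lists S"
  obtains z v k where "z = alt_word k s t \<or> z = alt_word k t s" "v \<in> lists S" "w \<approx> z @ v"
    "len w = k + len v" "len v < len (s # v)" "len v < len (t # v)"
proof -
  define Q where "Q v \<longleftrightarrow> (\<exists>z\<in>lists {s, t}. w \<approx> z @ v \<and> len w = length z + len v)" for v
  have "Q w" unfolding Q_def by (intro bexI[of _ "[]"]) auto
  then obtain v where v: "Q v" and min: "\<And>u. Q u \<Longrightarrow> len v \<le> len u"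
    using ex_has_least_nat[of Q w len] by auto
  obtain z where z: "z \<in> lists {s, t}" "w \<approx> z @ v" "len w = length z + len v"
    using v unfolding Q_def by blast
  have min_v: "len v < len (r # v)" if r: "r \<in> {s, t}" for r
  proof (rule ccontr)
    assume "\<not> ?thesis"
    moreover have rS: "r \<in> S" using r st by auto
    ultimately have 1: "len v = Suc (len (r # v))" using len_Cons[of r v] by auto
    have "w \<approx> (z @ [r]) @ r # v"
    proof -
      have "z @ v \<approx> z @ r # r # v"
        using thue_append[OF thue_refl thue_sym[OF cox_square[OF rS]]] .
      then show ?thesis using thue_trans[OF z(2)] by simp
    qed
    moreover have "z @ [r] \<in> lists {s, t}" using z(1) r by simp
    ultimately have "Q (r # v)" unfolding Q_def using 1 z(3) by fastforce
    then show False using min 1 by fastforce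
  qed
  have vS: "v \<in> lists S" using w cox_eq_lists[OF z(2)] by simp
  have "len (z @ v) = length z + len v" using len_cong[OF z(2)] z(3) by simp
  then obtain k where k: "z = alt_word k s t \<or> z = alt_word k t s"
    using alternating_reduced[OF st z(1)] by blast
  then have "length z = k" by auto
  then show thesis using that[OF k vS z(2)] z(3) min_v[of s] min_v[of t] by simp
qed

lemma alt_word_prefix_swap:
  assumes "s \<in> S" "t \<in> S" "m s t = enat n" "n \<le> k"
  obtains u where "alt_word k s t = alt_word n s t @ u" "alt_word k s t \<approx> alt_word n t s @ u"
proof -
  obtain j where "k = n + j" using assms(4) le_Suc_ex by blast
  then obtain u where u: "alt_word k s t = alt_word n s t @ u"
    using alt_word_add[of n j s t] by blast
  then have "alt_word k s t \<approx> alt_word n t s @ u"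
    using thue_append[OF braid_imp_cox[OF braid_rel[OF assms(1-3)]] thue_refl] by simp
  with u show thesis using that by blast
qed

text \<open>Induction on the length. A left descent \<open>t\<close> of \<open>w\<close> differs
  from \<open>s\<close>, and the dihedral decomposition for \<open>s\<close> and \<open>t\<close>
  has a nonempty head. The head sends the root of \<open>s\<close> to a nonnegative combination of
  the two roots, and the induction hypothesis applies to the shorter tail and both roots.\<close>

theorem root_nonneg:
  assumes "w \<in> lists S" "s \<in> S" "len w < len (s # w)"
  shows "0 \<le> wact w (simple_root s) x"
  using assms
proof (induction "len w" arbitrary: w s rule: less_induct)
  case less
  obtain w' where w': "w' \<approx> w" "length w' = len w" using len_ex .
  show ?case
  proof (cases w')
    case Nil
    then have "wact w = wact []" using wact_cox_eq[OF w'(1)] by simp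
    then show ?thesis by (simp add: simple_root_def)
  next
    case (Cons t w'')
    have w'S: "w' \<in> lists S" using cox_eq_lists[OF w'(1)] less(2) by simp
    then have t: "t \<in> S" using Cons by simp
    have "t # w \<approx> t # w'" using thue_Cons[OF thue_sym[OF w'(1)]] .
    also have "t # w' \<approx> w''" unfolding Cons by (rule cox_square[OF t])
    finally have "len (t # w) \<le> length w''" by (rule len_le[OF thue_sym])
    then have tw: "len (t # w) < len w" using w'(2) Cons by simp
    then have ts: "s \<noteq> t" using less(4) by auto
    obtain z v k where z: "z = alt_word k s t \<or> z = alt_word k t s" "v \<in> lists S" "w \<approx> z @ v"
      "len w = k + len v" "len v < len (s # v)" "len v < len (t # v)"
      using dihedral_decomposition[OF less(3) t less(2)] .
    then have zk: "length z = k" by auto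
    have k0: "k \<noteq> 0"
    proof
      assume "k = 0"
      then have "w \<approx> v" using z(1,3) by auto
      from len_cong[OF thue_Cons[OF this, of t]] len_cong[OF this] show False using z(6) tw by simp
    qed
    \<comment> \<open>If the head could be spelled with \<open>s\<close> in front, multiplying by
      \<open>s\<close> would shorten \<open>w\<close>.\<close>
    have not_s: False if "z \<approx> s # u" "length u < k" for u
    proof -
      have "s # w \<approx> s # z @ v" using thue_Cons[OF z(3)] .
      also have "s # z @ v \<approx> (s # s # u) @ v" using thue_append[OF thue_Cons[OF that(1)] thue_refl] by simp
      also have "(s # s # u) @ v \<approx> u @ v" using cox_square[OF less(3)] by simp
      finally have "len (s # w) = len (u @ v)" by (rule len_cong)
      also have "\<dots> \<le> length u + len v" using len_append_le[of u v] len_le_length[of u] by simp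
      finally show False using that(2) z(4) less(4) by simp
    qed
    have zalt: "z = alt_word k t s"
    proof (rule ccontr)
      assume "z \<noteq> alt_word k t s"
      then have "z = alt_word k s t" using z(1) by simp
      then show False using not_s[of "alt_word (k - 1) t s"] k0 by (cases k) auto
    qed
    \<comment> \<open>Otherwise a braid relation would bring \<open>s\<close> to the front of the
      head. The bound is needed for \<open>Suc k\<close>, as both \<open>qn s t k\<close> and
      \<open>qn s t (Suc k)\<close> occur as coefficients.\<close>
    have km: "enat (Suc k) \<le> m s t"
    proof (rule ccontr)
      assume "\<not> ?thesis"
      then obtain n where n: "m s t = enat n" "n \<le> k" by (cases "m s t") auto
      then have nt: "m t s = enat n" using m_sym less(3) t by simp
      from alt_word_prefix_swap[OF t less(3) nt n(2)]
      obtain u where u: "alt_word k t s = alt_word n t s @ u" "alt_word k t s \<approx> alt_word n s t @ u" .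
      obtain n' where n': "n = Suc n'" using m_enat_Suc[OF less(3) t n(1)] .
      show False using not_s[of "alt_word n' t s @ u"] u(2) arg_cong[OF u(1), of length]
        by (simp add: n' zalt)
    qed
    have "len v < len w" using z(4) k0 by simp
    then have pos: "0 \<le> wact v (simple_root s) x" "0 \<le> wact v (simple_root t) x"
      using less(1)[OF _ z(2)] z(5,6) less(3) t by blast+
    have "wact w (simple_root s) = wact v (wact (alt_word k t s) (simple_root s))"
      using wact_cox_eq[OF z(3)] zalt by simp
    moreover have "0 \<le> qn s t (Suc k)" "0 \<le> qn s t k"
      using qn_nonneg[OF less(3) t ts] km order_trans[OF _ km, of "enat k"] by simp_all
    ultimately show ?thesis
      using pos by (simp add: wact_alt_word_root[OF less(3) t ts] wact_linear)
  qed
qed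

section \<open>Descents as signs of roots, and Matsumoto's theorem\<close>

lemma wact_root_nonzero:
  assumes "w \<in> lists S" "wact w (simple_root s) = (\<lambda>x. 0)" shows False
proof -
  have "wact (w @ rev w) = wact []"
    using wact_cox_eq[OF cox_rev_cancel[of "rev w"]] assms(1) by (simp add: in_lists_conv_set)
  then have "wact (rev w) (wact w (simple_root s)) = simple_root s" by (metis wact_simps(1,3))
  moreover have "wact (rev w) (\<lambda>x. 0) = (\<lambda>x. 0)"
    using wact_linear[of "rev w" 0 _ 0] by simp
  ultimately have "simple_root s s = 0" using assms(2) by metis
  then show False by (simp add: simple_root_def)
qed

lemma root_nonpos:
  assumes "w \<in> lists S" "s \<in> S" "len (s # w) < len w"
  shows "wact w (simple_root s) x \<le> 0"
proof -
  have "len (s # s # w) = len w" by (intro len_cong cox_square assms)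
  then have "0 \<le> wact (s # w) (simple_root s) x" using assms by (intro root_nonneg) auto
  then show ?thesis using assms(2) by (simp add: reflection_root_same wact_minus)
qed

text \<open>A descent makes the root nonpositive, an ascent makes it nonnegative, and both cannot
  happen since the root is not zero.\<close>

lemma len_Cons_less_iff:
  assumes "w \<in> lists S" "s \<in> S"
  shows "len w < len (s # w) \<longleftrightarrow> (\<forall>x. 0 \<le> wact w (simple_root s) x)"
proof
  assume pos: "\<forall>x. 0 \<le> wact w (simple_root s) x"
  show "len w < len (s # w)"
  proof (rule ccontr)
    assume "\<not> ?thesis"
    then have "len (s # w) < len w" using len_Cons[OF assms(2), of w] by linarith
    then have "wact w (simple_root s) x = 0" for x 
      using root_nonpos[OF assms, of x] pos by (simp add: order_antisym)
    then show False using wact_root_nonzero[OF assms(1), of s] by blast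
  qed
qed (use root_nonneg[OF assms] in blast)

lemma len_Cons_less_iff':
  assumes "w \<in> lists S" "s \<in> S"
  shows "len (s # w) < len w \<longleftrightarrow> (\<forall>x. wact w (simple_root s) x \<le> 0)"
proof
  assume neg: "\<forall>x. wact w (simple_root s) x \<le> 0"
  show "len (s # w) < len w"
  proof (rule ccontr)
    assume "\<not> ?thesis"
    then have "len w < len (s # w)" using len_Cons[OF assms(2), of w] by linarith
    then have "wact w (simple_root s) x = 0" for x 
      using root_nonneg[OF assms, of x] neg by (simp add: order_antisym)
    then show False using wact_root_nonzero[OF assms(1), of s] by blast
  qed
qed (use root_nonpos[OF assms] in blast)

text \<open>The roots of \<open>s\<close> and \<open>t\<close> have nonnegative images under
  \<open>w\<close>, and the root tested by each new letter is a combination of them with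
  coefficients \<open>qn\<close>, nonnegative as long as the word has at most \<open>m s t\<close>
  letters.\<close>

lemma len_alt_word_append:
  assumes "s \<in> S" "t \<in> S" "s \<noteq> t" "w \<in> lists S" "len w < len (s # w)" "len w < len (t # w)"
    and "enat k \<le> m s t"
  shows "len (alt_word k s t @ w) = k + len w"
  using assms
proof (induction k arbitrary: s t)
  case (Suc k)
  have k: "enat k \<le> m t s" "enat k \<le> m s t"
    using Suc.prems(7) m_sym[OF Suc.prems(1,2)] by (auto intro: order_trans[of _ "enat (Suc k)"])
  have IH: "len (alt_word k t s @ w) = k + len w"
    using Suc.IH[of t s] Suc.prems k by auto
  have "0 \<le> wact (alt_word k t s @ w) (simple_root s) x" for x
    using root_nonneg[OF Suc.prems(4,1,5), of x] root_nonneg[OF Suc.prems(4,2,6), of x]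
      qn_nonneg[OF Suc.prems(1-3) Suc.prems(7)] qn_nonneg[OF Suc.prems(1-3) k(2)]
    by (simp add: wact_alt_word_root[OF Suc.prems(1-3)] wact_linear)
  moreover have "alt_word k t s @ w \<in> lists S"
    using Suc.prems alt_word_in_lists[of t S s k] by auto
  ultimately have "len (alt_word k t s @ w) < len (s # alt_word k t s @ w)"
    using len_Cons_less_iff Suc.prems(1) by blast
  then show ?case using len_Cons[OF Suc.prems(1), of "alt_word k t s @ w"] IH by auto
qed simp

lemma len_append_alt_word:
  assumes "s \<in> S" "t \<in> S" "s \<noteq> t" "w \<in> lists S" "len w < len (w @ [s])" "len w < len (w @ [t])"
    and "enat k \<le> m s t"
  shows "len (w @ alt_word k s t) = len w + k"
proof -
  have snoc: "len (r # rev w) = len (w @ [r])" for r using len_rev[of "w @ [r]"] by simp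
  \<comment> \<open>Reversal exchanges the two letters when \<open>k\<close> is even, so both orders
    are needed.\<close>
  have "len (alt_word k a b @ rev w) = k + len w" if "a = s \<and> b = t \<or> a = t \<and> b = s" for a b
    using that assms m_sym[OF assms(1,2)] snoc
    by (subst len_alt_word_append) (auto simp: in_lists_conv_set)
  then have "len (rev (w @ alt_word k s t)) = k + len w" by (simp add: rev_alt_word)
  then show ?thesis by (simp only: len_rev) 
qed

text \<open>Two descents force the dihedral head of \<open>x\<close> to have at least
  \<open>m s t\<close> letters; in particular \<open>m s t\<close> is finite. A braid relation then
  makes the head start with \<open>s\<close>.\<close>

lemma two_left_descents:
  assumes st: "s \<in> S" "t \<in> S" "s \<noteq> t" and x: "x \<in> lists S" and desc: "len (s # x) < len x" "len (t # x) < len x"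
  obtains n v where "m s t = enat n" "x \<approx> alt_word n s t @ v" "len x = n + length v"
proof -
  obtain z v k where z: "z = alt_word k s t \<or> z = alt_word k t s" "v \<in> lists S" "x \<approx> z @ v"
      "len x = k + len v" "len v < len (s # v)" "len v < len (t # v)"
    using dihedral_decomposition[OF st(1,2) x] .
  then have zk: "length z = k" by auto
  have "\<exists>n. m s t = enat n \<and> n \<le> k"
  proof (rule ccontr)
    assume "\<not> ?thesis"
    then have "m s t = enat n \<Longrightarrow> k < n" for n by (meson not_le)
    then have k: "enat (Suc k) \<le> m s t" by (cases "m s t") (simp_all add: Suc_le_eq)
    \<comment> \<open>A head shorter than \<open>m s t\<close> still grows by its missing letter
      \<open>b\<close>, so \<open>b\<close> is not a descent.\<close>
    have False if "z = alt_word k a b" "a = s \<and> b = t \<or> a = t \<and> b = s" for a b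
    proof -
      have "len (alt_word (Suc k) b a @ v) = Suc k + len v"
        using that(2) st z k m_sym[OF st(1,2)] by (intro len_alt_word_append) auto
      moreover have "len (b # x) = len (b # z @ v)" using len_cong[OF thue_Cons[OF z(3)]] .
      ultimately show False using that z(4) desc by auto
    qed
    from this[of s t] this[of t s] show False using z(1) by blast
  qed
  then obtain n where n: "m s t = enat n" "n \<le> k" by blast
  have "\<exists>u. z \<approx> alt_word n s t @ u \<and> k = n + length u"
    using z(1)
  proof
    assume z: "z = alt_word k s t"
    obtain u where u: "alt_word k s t = alt_word n s t @ u"
      using alt_word_prefix_swap[OF st(1,2) n] by blast
    have "k = n + length u" using arg_cong[OF u, of length] by simp
    then show ?thesis unfolding z u by blast
  next
    assume z: "z = alt_word k t s"
    have "m t s = enat n" using n(1) m_sym[OF st(1,2)] by simp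
    from alt_word_prefix_swap[OF st(2,1) this n(2)]
    obtain u where u: "alt_word k t s = alt_word n t s @ u" "alt_word k t s \<approx> alt_word n s t @ u" .
    have "k = n + length u" using arg_cong[OF u(1), of length] by simp
    then show ?thesis unfolding z using u(2) by blast
  qed
  then obtain u where u: "z \<approx> alt_word n s t @ u" "k = n + length u" by blast
  obtain v' where v': "v' \<approx> v" "length v' = len v" using len_ex .
  have "x \<approx> z @ v" using z(3) .
  also have "z @ v \<approx> (alt_word n s t @ u) @ v'" using thue_append[OF u(1) thue_sym[OF v'(1)]] .
  finally have "x \<approx> alt_word n s t @ u @ v'" by simp
  moreover have "len x = n + length (u @ v')" using z(4) u(2) v'(2) by simp
  ultimately show thesis by (rule that[OF n(1)])
qed

text \<open>If the first letters agree they cancel and induction applies. Otherwise both are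
  descents, so \<open>x\<close> equals in the Coxeter group a reduced word starting with a full
  braid word. Each of \<open>x\<close> and \<open>y\<close> shares its first letter with one side of
  that braid relation, which reduces to the first case.\<close>

theorem matsumoto:
  assumes "reduced x" "reduced y" "x \<in> lists S" "x \<approx> y"
  shows "x \<sim> y"
  using assms
proof (induction "length x" arbitrary: x y rule: less_induct)
  case less
  have len: "length y = length x" using len_cong[OF less(5)] less(2,3) by simp
  have yS: "y \<in> lists S" using cox_eq_lists[OF less(5)] less(4) by simp
  show ?case
  proof (cases x)
    case Nil
    then show ?thesis using len by simp
  next
    case x: (Cons s a)
    then obtain t b where y: "y = t # b" using len by (cases y) auto
    have st: "s \<in> S" "t \<in> S" and ab: "a \<in> lists S" "b \<in> lists S" using x y less(4) yS by auto
    have red: "reduced a" "reduced b" using reduced_append[of "[s]" a] reduced_append[of "[t]" b] less(2,3) x y by auto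
    have IH: "u \<sim> v" if "reduced (r # u)" "reduced (r # v)" "r # u \<approx> r # v" "r \<in> S" "u \<in> lists S" "length u = length a" for r u v
    proof (rule less(1))
      show "length u < length x" using that(6) x by simp
      show "reduced u" "reduced v"
        using reduced_append[of "[r]"] that(1,2) by simp_all
      show "u \<in> lists S" "u \<approx> v" using that(5) cox_cancel_Cons[OF that(4,3)] by simp_all
    qed
    show ?thesis
    proof (cases "s = t")
      case True
      have "a \<sim> b"
        by (rule IH[of s]) (use less(2,3,5) True x y st ab in simp_all)
      then show ?thesis using thue_Cons True x y by simp
    next
      case False
      have "len (s # x) < len x" using len_cong[OF cox_square[OF st(1), of a]] red less(2) x by simp
      moreover have "len (t # x) < len x"
      proof -
        have "t # x \<approx> t # t # b" using thue_Cons[OF less(5)] y by simp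
        also have "t # t # b \<approx> b" by (rule cox_square[OF st(2)])
        finally have "len (t # x) = len b" by (rule len_cong)
        then show ?thesis using red less(2) len x y by simp
      qed
      ultimately obtain n v where v: "m s t = enat n" "x \<approx> alt_word n s t @ v" "len x = n + length v"
        using two_left_descents[OF st False less(4)] by blast
      obtain n' where n: "n = Suc n'" using m_enat_Suc[OF st v(1)] .
      have sw: "alt_word n s t @ v \<sim> alt_word n t s @ v"
        using thue_append[OF braid_rel[OF st v(1)] thue_refl] .
      have red': "reduced (alt_word n s t @ v)" using len_cong[OF v(2)] v(3) by simp
      moreover have "len (alt_word n t s @ v) = len (alt_word n s t @ v)"
        using len_cong[OF braid_imp_cox[OF sw]] by simp
      ultimately have red'': "reduced (alt_word n t s @ v)" by simp
      have "y \<approx> alt_word n t s @ v"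
        using thue_trans[OF thue_trans[OF thue_sym[OF less(5)] v(2)] braid_imp_cox[OF sw]] .
      then have "b \<sim> alt_word n' s t @ v"
        by (intro IH[of t]) (use red'' less(3) y n st ab len x in simp_all)
      from thue_Cons[OF this, of t] have 2: "y \<sim> alt_word n t s @ v" by (simp add: y n)
      have "a \<sim> alt_word n' t s @ v"
        by (intro IH[of s]) (use red' less(2) x n st ab v(2) in simp_all)
      from thue_Cons[OF this, of s] have 1: "x \<sim> alt_word n s t @ v" by (simp add: x n)
      show ?thesis using thue_trans[OF 1 thue_trans[OF sw thue_sym[OF 2]]] .
    qed
  qed
qed

section \<open>Cancellation and least common multiples of positive braids\<close>

text \<open>Both \<open>s # a\<close> and \<open>t # b\<close> are the least common multiple of
  \<open>s\<close> and \<open>t\<close> followed by \<open>c\<close>. Since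
  \<open>m s s = 1\<close>, the case s = t has n = 0 and expresses left cancellation.\<close>

definition linked :: "'a \<Rightarrow> 'a list \<Rightarrow> 'a \<Rightarrow> 'a list \<Rightarrow> bool" where
  "linked s a t b \<longleftrightarrow> (\<exists>n c. m s t = enat (Suc n) \<and> a \<sim> alt_word n t s @ c \<and> b \<sim> alt_word n s t @ c)"

lemma linked_same_iff:
  assumes "s \<in> S" shows "linked s a s b \<longleftrightarrow> a \<sim> b"
proof
  assume "linked s a s b"
  then obtain c where "a \<sim> c" "b \<sim> c"
    unfolding linked_def using m_refl[OF assms] by (auto simp: one_enat_def)
  then show "a \<sim> b" using thue_trans thue_sym by metis
next
  assume "a \<sim> b"
  then show "linked s a s b"
    unfolding linked_def using m_refl[OF assms]
    by (intro exI[of _ 0] exI[of _ b]) (simp add: one_enat_def)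
qed

text \<open>A rewriting step either takes place at the front, where it is the defining braid
  relation, or keeps the first letter.\<close>

lemma rewr_braid_linked:
  assumes "s \<in> S" "rewr (braid_rels S m) (s # a) (t # b)"
  shows "linked s a t b"
proof -
  obtain p q l r where lr: "(l, r) \<in> braid_rels S m \<or> (r, l) \<in> braid_rels S m"
    and p: "s # a = p @ l @ q" "t # b = p @ r @ q"
    using assms(2) unfolding rewr_def by blast
  then obtain n x y where xy: "x \<in> S" "y \<in> S" "x \<noteq> y" "m x y = enat n"
    "l = alt_word n x y" "r = alt_word n y x"
    unfolding braid_rels_def using m_sym by fastforce
  obtain k where k: "n = Suc k" using m_enat_Suc[OF xy(1,2,4)] .
  show ?thesis
  proof (cases p)
    case Nil
    then show ?thesis using p xy k unfolding linked_def by (intro exI[of _ k] exI[of _ q]) simp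
  next
    case (Cons h p')
    then have "s = t" "a = p' @ l @ q" "b = p' @ r @ q" using p by simp_all
    moreover have "l \<sim> r" using braid_rel[OF xy(1,2,4)] xy(5,6) by simp
    ultimately have "a \<sim> b" using thue_context by simp
    then show ?thesis using linked_same_iff[OF assms(1)] \<open>s = t\<close> by simp
  qed
qed

section \<open>Garside's induction for common multiples of generators\<close>

lemma reduced_braid_eq: "u \<sim> v \<Longrightarrow> reduced u \<longleftrightarrow> reduced v"
  using len_cong[OF braid_imp_cox] braid_eq_length by simp

text \<open>The induction hypothesis of Garside's argument, isolated so that cancellation is
  available for short words before it is known in general.\<close>

definition linked_below :: "nat \<Rightarrow> bool" where
  "linked_below N \<longleftrightarrow> (\<forall>s a t b. s # a \<in> lists S \<and> s # a \<sim> t # b \<and> length a < N \<longrightarrow> linked s a t b)"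

lemma linked_belowD:
  "linked_below N \<Longrightarrow> s # a \<in> lists S \<Longrightarrow> s # a \<sim> t # b \<Longrightarrow> length a < N \<Longrightarrow> linked s a t b"
  unfolding linked_below_def by blast

lemma linked_below_cancel:
  assumes "linked_below N" "p @ e \<in> lists S" "p @ e \<sim> p @ f" "length (p @ e) \<le> N"
  shows "e \<sim> f"
  using assms(2-4)
proof (induction p)
  case (Cons s p)
  have "linked s (p @ e) s (p @ f)"
    using linked_belowD[OF assms(1), of s "p @ e" s "p @ f"] Cons.prems by simp
  then have "p @ e \<sim> p @ f" using linked_same_iff Cons.prems(1) by simp
  then show ?case using Cons by simp
qed simp

text \<open>The braid \<open>c\<close> is arbitrary; only its left divisor \<open>w\<close>,
  preceded by \<open>u\<close>, is required to be reduced, so that \<open>u # w\<close> is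
  controlled by the Coxeter group.\<close>

definition simple_divisor :: "'a \<Rightarrow> 'a list \<Rightarrow> 'a list \<Rightarrow> bool" where
  "simple_divisor u c w \<longleftrightarrow> reduced (u # w) \<and> (\<exists>d. c \<sim> w @ d)"

lemma simple_divisor_cong:
  assumes "simple_divisor u c w" "w \<sim> w'" shows "simple_divisor u c w'"
proof -
  obtain d where "reduced (u # w)" "c \<sim> w @ d" using assms(1) unfolding simple_divisor_def by blast
  then have "reduced (u # w')" "c \<sim> w' @ d"
    using reduced_braid_eq[OF thue_Cons[OF assms(2)]] thue_trans[OF _ thue_append[OF assms(2) thue_refl]]
    by simp_all
  then show ?thesis unfolding simple_divisor_def by blast
qed

text \<open>A diamond argument: where two extensions of \<open>w\<close> branch into distinct
  letters, the common multiple of these letters is again an admissible extension. The measure is the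
  room left in \<open>c\<close> after \<open>w\<close>.\<close>

lemma simple_divisor_confluent:
  assumes below: "linked_below (length c)" and u: "u \<in> S" and c: "c \<in> lists S"
    and "simple_divisor u c (w @ p)" "simple_divisor u c (w @ q)"
  shows "\<exists>r p' q'. simple_divisor u c r \<and> r \<sim> w @ p @ p' \<and> r \<sim> w @ q @ q'"
  using assms(4,5)
proof (induction "length c - length w" arbitrary: w p q rule: less_induct)
  case less
  have bound: "length v \<le> length c" "v \<in> lists S" if "simple_divisor u c v" for v
    using that braid_eq_length braid_eq_lists[of c] c unfolding simple_divisor_def by fastforce+
  show ?case
  proof (cases p)
    case Nil
    then show ?thesis
      using less(3) by (intro exI[of _ "w @ q"] exI[of _ q] exI[of _ "[]"]) simp
  next
    case p: (Cons s p1)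
    show ?thesis
    proof (cases q)
      case Nil
      then show ?thesis
        using less(2) by (intro exI[of _ "w @ p"] exI[of _ "[]"] exI[of _ p]) simp
    next
      case q: (Cons t q1)
      have st: "s \<in> S" "t \<in> S" and w: "w \<in> lists S"
        using bound(2)[OF less(2)] bound(2)[OF less(3)] p q by simp_all
      have lt: "length c - length v < length c - length w" if "length w < length v" for v
        using that bound(1)[OF less(2)] p by simp
      show ?thesis
      proof (cases "s = t")
        case True
        have "\<exists>r p' q'. simple_divisor u c r \<and> r \<sim> (w @ [s]) @ p1 @ p' \<and> r \<sim> (w @ [s]) @ q1 @ q'"
          by (rule less(1)[OF lt]) (use less(2,3) p q True in simp_all)
        then show ?thesis using p q True by simp
      next
        case False
        obtain d1 d2 where d: "c \<sim> w @ s # p1 @ d1" "c \<sim> w @ t # q1 @ d2"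
          using less(2,3) p q unfolding simple_divisor_def by auto
        have wd: "w @ s # p1 @ d1 \<in> lists S" using braid_eq_lists[OF d(1)] c by simp
        have "w @ s # p1 @ d1 \<sim> w @ t # q1 @ d2" using thue_trans[OF thue_sym[OF d(1)] d(2)] .
        from linked_below_cancel[OF below wd this]
        have "s # p1 @ d1 \<sim> t # q1 @ d2" using braid_eq_length[OF d(1)] by simp
        from linked_belowD[OF below _ this]
        have "linked s (p1 @ d1) t (q1 @ d2)" using braid_eq_length[OF d(1)] wd by simp
        then obtain n g where n: "m s t = enat (Suc n)" and g: "p1 @ d1 \<sim> alt_word n t s @ g"
          unfolding linked_def by blast
        let ?a = "alt_word (Suc n) s t" and ?b = "alt_word (Suc n) t s"
        have ab: "?b \<sim> ?a" using braid_rel[OF st n] by (rule thue_sym)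
        have "c \<sim> w @ ?a @ g"
          using thue_trans[OF d(1) thue_append[OF thue_refl[of _ w] thue_Cons[OF g, of s]]] by simp
        \<comment> \<open>Neither letter is a right descent of \<open>u # w\<close>, so the whole
          alternating word can be appended without loss of length.\<close>
        moreover have "reduced (u # w @ ?a)"
        proof -
          have "reduced ((u # w) @ [s] @ p1)" "reduced ((u # w) @ [t] @ q1)"
            using less(2,3) p q unfolding simple_divisor_def by simp_all
          then have "reduced (u # w)" "reduced ((u # w) @ [s])" "reduced ((u # w) @ [t])"
            using reduced_append(1)[of "(u # w) @ [s]" p1] reduced_append(1)[of "(u # w) @ [t]" q1]
              reduced_append(1)[of "u # w" "[s]"] by simp_all
          then have "len ((u # w) @ ?a) = len (u # w) + Suc n"
            using st False u w n by (intro len_append_alt_word) simp_all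
          then show ?thesis using \<open>reduced (u # w)\<close> by simp
        qed
        ultimately have Xa: "simple_divisor u c (w @ ?a)" unfolding simple_divisor_def by auto
        then have Xb: "simple_divisor u c (w @ ?b)"
          by (rule simple_divisor_cong) (intro thue_append thue_sym[OF ab] thue_refl)
        \<comment> \<open>The first branch is joined with the common multiple spelled from
          \<open>s\<close>, then the second with the one spelled from \<open>t\<close>; the two
          results both extend \<open>w @ ?a\<close> and are joined last.\<close>
        have "\<exists>r p' q'. simple_divisor u c r \<and> r \<sim> (w @ [s]) @ p1 @ p' \<and> r \<sim> (w @ [s]) @ alt_word n t s @ q'"
          by (rule less(1)[OF lt]) (use less(2) p Xa in simp_all)
        then obtain r1 p1' h1 where r1: "simple_divisor u c r1" "r1 \<sim> w @ p @ p1'" "r1 \<sim> w @ ?a @ h1"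
          using p by auto
        have "\<exists>r p' q'. simple_divisor u c r \<and> r \<sim> (w @ [t]) @ q1 @ p' \<and> r \<sim> (w @ [t]) @ alt_word n s t @ q'"
          by (rule less(1)[OF lt]) (use less(3) q Xb in simp_all)
        then obtain r2 q1' h2 where r2: "simple_divisor u c r2" "r2 \<sim> w @ q @ q1'" "r2 \<sim> w @ ?b @ h2"
          using q by auto
        have r2': "r2 \<sim> w @ ?a @ h2"
          using thue_trans[OF r2(3) thue_context[OF ab]] .
        have "\<exists>r p' q'. simple_divisor u c r \<and> r \<sim> (w @ ?a) @ h1 @ p' \<and> r \<sim> (w @ ?a) @ h2 @ q'"
          by (rule less(1)[OF lt])
            (use simple_divisor_cong[OF r1(1,3)] simple_divisor_cong[OF r2(1) r2'] in simp_all)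
        then obtain r k1 k2 where r: "simple_divisor u c r"
            "r \<sim> (w @ ?a @ h1) @ k1" "r \<sim> (w @ ?a @ h2) @ k2" by auto
        have "r \<sim> (w @ p @ p1') @ k1"
          using thue_trans[OF r(2) thue_append[OF thue_trans[OF thue_sym[OF r1(3)] r1(2)] thue_refl]] .
        moreover have "r \<sim> (w @ q @ q1') @ k2"
          using thue_trans[OF r(3) thue_append[OF thue_trans[OF thue_sym[OF r2'] r2(2)] thue_refl]] .
        ultimately show ?thesis
          using r(1) by (intro exI[of _ r] exI[of _ "p1' @ k1"] exI[of _ "q1' @ k2"]) simp
      qed
    qed
  qed
qed

text \<open>The case of three generators. Both decompositions of \<open>c\<close> begin with the
  rest of a braid word after \<open>u\<close>, and confluence yields a common simple extension
  \<open>r\<close>. The reduced word \<open>u # r\<close> has the descents \<open>s\<close> and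
  \<open>t\<close>, so in the Coxeter group it starts with their braid word, and Matsumoto's theorem
  lifts this to braids.\<close>

lemma linked_trans:
  assumes below: "linked_below (length c)" and S: "s \<in> S" "t \<in> S" "u \<in> S" and c: "c \<in> lists S"
    and su: "linked s a u c" and ut: "linked u c t b"
  shows "linked s a t b"
proof -
  obtain n1 e where n1: "m s u = enat (Suc n1)" and a: "a \<sim> alt_word n1 u s @ e" and ce: "c \<sim> alt_word n1 s u @ e"
    using su unfolding linked_def by blast
  obtain n2 f where n2: "m u t = enat (Suc n2)" and cf: "c \<sim> alt_word n2 t u @ f" and b: "b \<sim> alt_word n2 u t @ f"
    using ut unfolding linked_def by blast
  have eS: "alt_word n1 s u @ e \<in> lists S" using braid_eq_lists[OF ce] c by simp
  have fS: "alt_word n2 t u @ f \<in> lists S" using braid_eq_lists[OF cf] c by simp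
  show ?thesis
  proof (cases "s = t")
    case True
    then have "n2 = n1" using n1 n2 m_sym S by simp
    then have "alt_word n1 s u @ e \<sim> alt_word n1 s u @ f"
      using thue_trans[OF thue_sym[OF ce] cf] True by simp
    from linked_below_cancel[OF below eS this] have "e \<sim> f" using braid_eq_length[OF ce] by simp
    from thue_trans[OF a thue_append[OF thue_refl this]]
    have "a \<sim> b" using thue_trans[OF _ thue_sym[OF b]] True \<open>n2 = n1\<close> by simp
    then show ?thesis using linked_same_iff[OF S(1)] True by simp
  next
    case st: False
    \<comment> \<open>Preceded by \<open>u\<close> this is a full braid word, hence reduced; for
      \<open>u = r\<close> it is a single letter.\<close>
    have sq: "simple_divisor u c (alt_word n r u)" if "r \<in> S" "m u r = enat (Suc n)" "c \<sim> alt_word n r u @ g" for r n g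
    proof -
      have "len (alt_word (Suc n) u r @ []) = Suc n + len []"
      proof (cases "u = r")
        case True
        then have "n = 0" using that(2) m_refl[OF S(3)] by (simp add: one_enat_def)
        then show ?thesis using reduced_singleton[OF S(3)] by simp
      next
        case False
        show ?thesis
          by (rule len_alt_word_append)
            (use False that(1,2) S(3) reduced_singleton in simp_all)
      qed
      then show ?thesis using that(3) unfolding simple_divisor_def by auto
    qed
    have "m u s = enat (Suc n1)" using n1 m_sym S by simp
    from simple_divisor_confluent[OF below S(3) c, of "[]" "alt_word n1 s u" "alt_word n2 t u"]
      sq[OF S(1) this ce] sq[OF S(2) n2 cf]
    obtain r p q where r: "simple_divisor u c r" "r \<sim> alt_word n1 s u @ p" "r \<sim> alt_word n2 t u @ q"
      by auto
    obtain d where d: "reduced (u # r)" "c \<sim> r @ d" using r(1) unfolding simple_divisor_def by blast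
    have rS: "r \<in> lists S" using braid_eq_lists[OF d(2)] c by simp
    \<comment> \<open>Two spellings of \<open>u # r\<close>, starting with \<open>s\<close> and with
      \<open>t\<close>.\<close>
    define x where "x = s # alt_word n1 u s @ p"
    define y where "y = t # alt_word n2 u t @ q"
    have x: "x \<sim> u # r"
    proof -
      have "alt_word (Suc n1) s u @ p \<sim> alt_word (Suc n1) u s @ p"
        using thue_append[OF braid_rel[OF S(1,3) n1] thue_refl] .
      then show ?thesis using thue_trans[OF _ thue_Cons[OF thue_sym[OF r(2)], of u]] by (simp add: x_def)
    qed
    have y: "y \<sim> u # r"
    proof -
      have "m t u = enat (Suc n2)" using n2 m_sym S by simp
      then have "alt_word (Suc n2) t u @ q \<sim> alt_word (Suc n2) u t @ q"
        using thue_append[OF braid_rel[OF S(2,3)] thue_refl] by blast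
      then show ?thesis using thue_trans[OF _ thue_Cons[OF thue_sym[OF r(3)], of u]] by (simp add: y_def)
    qed
    have xy: "x \<sim> y" using thue_trans[OF x thue_sym[OF y]] .
    have red: "reduced x" "reduced y" using reduced_braid_eq[OF x] reduced_braid_eq[OF y] d(1) by simp_all
    have xS: "x \<in> lists S" "y \<in> lists S" using braid_eq_lists[OF x] braid_eq_lists[OF y] rS S by simp_all
    have desc: "len (h # z) < len z" if "z = h # z'" "reduced z" "h \<in> S" for h z z'
    proof -
      have "len (h # z) \<le> length z'"
        using len_square_less[OF that(3), of z'] len_le_length[of z'] that(1) by simp
      then show ?thesis using that(1,2) by simp
    qed
    have "len (t # x) < len x"
      using desc[OF y_def red(2) S(2)] len_cong[OF braid_imp_cox[OF thue_Cons[OF xy, of t]]]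
        len_cong[OF braid_imp_cox[OF xy]] by simp
    from two_left_descents[OF S(1,2) st xS(1) desc[OF x_def red(1) S(1)] this]
    obtain n v where v: "m s t = enat n" "x \<approx> alt_word n s t @ v" "len x = n + length v" .
    obtain n' where n: "n = Suc n'" using m_enat_Suc[OF S(1,2) v(1)] .
    have sw: "alt_word n s t @ v \<sim> alt_word n t s @ v"
      using thue_append[OF braid_rel[OF S(1,2) v(1)] thue_refl] .
    have redv: "reduced (alt_word n s t @ v)" using len_cong[OF v(2)] v(3) by simp
    have strip: "z' \<sim> w'" if "z = h # z'" "w = h # w'" "reduced z" "reduced w" "z \<in> lists S" "z \<approx> w" for h z w z' w'
    proof (rule matsumoto)
      show "reduced z'" "reduced w'"
        using reduced_append(2)[of "[h]" z'] reduced_append(2)[of "[h]" w'] that(1-4) by simp_all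
      show "z' \<in> lists S" "z' \<approx> w'" using that cox_cancel_Cons[of h z' w'] by simp_all
    qed
    have xv: "alt_word n1 u s @ p \<sim> alt_word n' t s @ v"
      by (rule strip[OF x_def _ red(1) redv xS(1) v(2)]) (simp add: n)
    have "y \<approx> alt_word n t s @ v"
      using thue_trans[OF thue_trans[OF thue_sym[OF braid_imp_cox[OF xy]] v(2)] braid_imp_cox[OF sw]] .
    then have yv: "alt_word n2 u t @ q \<sim> alt_word n' s t @ v"
      using reduced_braid_eq[OF sw] redv by (intro strip[OF y_def _ red(2) _ xS(2)]) (simp_all add: n)
    \<comment> \<open>Both sides spell \<open>c\<close>. Cancelling the common prefix shows that
      \<open>e\<close> is \<open>p\<close> followed by the part \<open>d\<close> of \<open>c\<close>
      beyond \<open>r\<close>, which carries the factorisation of \<open>x\<close> over to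
      \<open>a\<close>.\<close>
    have "alt_word n1 s u @ e \<sim> alt_word n1 s u @ p @ d"
      using thue_trans[OF thue_trans[OF thue_sym[OF ce] d(2)] thue_append[OF r(2) thue_refl]] by simp
    from linked_below_cancel[OF below eS this] have "e \<sim> p @ d"
      using braid_eq_length[OF ce] by simp
    from thue_trans[OF a thue_append[OF thue_refl this]] thue_append[OF xv thue_refl[of _ d]]
    have ad: "a \<sim> alt_word n' t s @ v @ d" using thue_trans by fastforce
    have "alt_word n2 t u @ f \<sim> alt_word n2 t u @ q @ d"
      using thue_trans[OF thue_trans[OF thue_sym[OF cf] d(2)] thue_append[OF r(3) thue_refl]] by simp
    from linked_below_cancel[OF below fS this] have "f \<sim> q @ d"
      using braid_eq_length[OF cf] by simp
    from thue_trans[OF b thue_append[OF thue_refl this]] thue_append[OF yv thue_refl[of _ d]]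
    have bd: "b \<sim> alt_word n' s t @ v @ d" using thue_trans by fastforce
    show ?thesis unfolding linked_def using v(1) n ad bd by blast
  qed
qed

text \<open>An inner induction runs along the chain of rewriting steps. Each step links its two
  words, and \<open>linked_trans\<close> composes the links, using the outer induction on the
  length.\<close>

theorem braid_eq_Cons_linked:
  assumes "s # a \<in> lists S" "s # a \<sim> t # b"
  shows "linked s a t b"
  using assms
proof (induction "length a" arbitrary: s a t b rule: less_induct)
  case less
  have below: "linked_below (length a)"
    unfolding linked_below_def using less(1) by blast
  have "\<forall>t b. z = t # b \<longrightarrow> linked s a t b" if "s # a \<sim> z" for z
    using that unfolding thue_def
  proof (induction rule: rtranclp_induct)
    case base
    then show ?case using linked_same_iff[of s] less(2) by simp
  next
    case (step y z)
    have y: "s # a \<sim> y" using step(1) unfolding thue_def .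
    then obtain u c where uc: "y = u # c" "length c = length a"
      using braid_eq_length[OF y] by (cases y) auto
    have ucS: "u \<in> S" "c \<in> lists S" using braid_eq_lists[OF y] less(2) uc by simp_all
    show ?case
    proof (intro allI impI)
      fix t b assume z: "z = t # b"
      have "s # a \<sim> z" using y step(2) unfolding thue_def by simp
      then have t: "t \<in> S" using braid_eq_lists[of "s # a" z] less(2) z by simp
      have "linked u c t b" using rewr_braid_linked[OF ucS(1)] step(2) uc z by simp
      then show "linked s a t b"
        using linked_trans[of c s t u a b] below uc less(2) t ucS step(3) by simp
    qed
  qed
  then show ?case using less(3) by blast
qed

section \<open>Cancellation on both sides and common right divisors\<close>

lemma braid_cancel_left:
  assumes "p @ a \<in> lists S" "p @ a \<sim> p @ b" shows "a \<sim> b"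
proof (rule linked_below_cancel[OF _ assms order_refl])
  show "linked_below (length (p @ a))"
    unfolding linked_below_def using braid_eq_Cons_linked by blast
qed

lemma braid_cancel_right:
  assumes "a @ p \<in> lists S" "a @ p \<sim> b @ p" shows "a \<sim> b"
proof -
  have "rev p @ rev a \<sim> rev p @ rev b" using braid_eq_rev[OF assms(2)] by simp
  moreover have "rev p @ rev a \<in> lists S" using assms(1) by (auto simp: in_lists_conv_set)
  ultimately have "rev a \<sim> rev b" by (rule braid_cancel_left[rotated])
  then show ?thesis using braid_eq_rev by fastforce
qed

lemma common_right_divisor:
  assumes "x @ [s] \<in> lists S" "x @ [s] \<sim> y @ [t]"
  obtains n c where "m s t = enat (Suc n)" "x \<sim> c @ rev (alt_word n t s)" "y \<sim> c @ rev (alt_word n s t)"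
proof -
  have "s # rev x \<sim> t # rev y" using braid_eq_rev[OF assms(2)] by simp
  moreover have "s # rev x \<in> lists S" using assms(1) by (auto simp: in_lists_conv_set)
  ultimately have "linked s (rev x) t (rev y)" by (rule braid_eq_Cons_linked[rotated])
  then obtain n c where 1: "m s t = enat (Suc n)" 
    "rev x \<sim> alt_word n t s @ c" "rev y \<sim> alt_word n s t @ c"
    unfolding linked_def by blast
  show thesis
    using that[OF 1(1), of "rev c"] braid_eq_rev[OF 1(2)] braid_eq_rev[OF 1(3)] by simp
qed

text \<open>If the two letters were equal in the Coxeter group, \<open>t\<close> would be a descent
  of \<open>[s]\<close>. But the reflection in a different letter keeps the coefficient 1 of the
  root of \<open>t\<close>.\<close>

lemma cox_letters_eq:
  assumes "s \<in> S" "t \<in> S" "[s] \<approx> [t]" shows "s = t"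
proof -
  have "t # s # [] \<approx> t # t # []" using thue_Cons[OF assms(3)] .
  also have "t # t # [] \<approx> []" by (rule cox_square[OF assms(2)])
  finally have "len [t, s] = 0" using len_cong by fastforce
  then have "len (t # [s]) < len [s]" using reduced_singleton[OF assms(1)] by simp
  then have "wact [s] (simple_root t) t \<le> 0" using assms by (intro root_nonpos) simp_all
  then show ?thesis
    using assms(1,2) by (auto simp: reflection_def simple_root_def split: if_splits)
qed

section \<open>The Garside element\<close>

text \<open>The longest element described through its descents, which makes sense without
  finiteness.\<close>

definition full_descent :: "'a list \<Rightarrow> bool" where
  "full_descent x \<longleftrightarrow> x \<in> lists S \<and> (\<forall>s\<in>S. len (s # x) < len x)"

lemma wact_supported:
  assumes "w \<in> lists S" "\<And>y. y \<notin> S \<Longrightarrow> v y = 0" "y \<notin> S"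
  shows "wact w v y = 0"
  using assms(1,2)
proof (induction w arbitrary: v rule: list.induct)
  case (Cons s w)
  have "wact w (reflection s v) y = 0"
    by (rule Cons.IH) (use Cons.prems in \<open>auto simp: reflection_def\<close>)
  then show ?case by simp
qed (use assms(3) in simp)

lemma wact_sum:
  "finite F \<Longrightarrow> wact w (\<lambda>y. \<Sum>t\<in>F. a t * f t y) = (\<lambda>y. \<Sum>t\<in>F. a t * wact w (f t) y)"
proof (induction F rule: finite_induct)
  case empty
  show ?case using wact_linear[of w 0 _ 0] by simp
next
  case (insert t F)
  then show ?case using wact_linear[of w "a t" "f t" 1 "\<lambda>y. \<Sum>t\<in>F. a t * f t y"] by simp
qed

lemma full_descent_nonpos:
  assumes x: "full_descent x" and v: "\<And>y. y \<notin> S \<Longrightarrow> v y = 0" "\<And>y. 0 \<le> v y"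
  shows "wact x v y \<le> 0"
proof -
  have "v z = (\<Sum>t\<in>S. v t * simple_root t z)" for z
    using v(1) finite_S by (cases "z \<in> S") (auto simp: simple_root_def if_distrib cong: if_cong)
  then have "v = (\<lambda>z. \<Sum>t\<in>S. v t * simple_root t z)" by (rule ext)
  then have "wact x v y = (\<Sum>t\<in>S. v t * wact x (simple_root t) y)"
    using wact_sum[OF finite_S, of x v simple_root] by metis
  also have "\<dots> \<le> 0"
    using x v(2) root_nonpos unfolding full_descent_def
    by (intro sum_nonpos mult_nonneg_nonpos) auto
  finally show ?thesis .
qed

text \<open>For a reduced word \<open>s # v\<close> the image of the root of \<open>s\<close> under
  \<open>v\<close> is nonnegative, and \<open>x\<close> turns nonnegative vectors into nonpositive
  ones. So every new letter is a descent.\<close>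

lemma len_append_full_descent:
  assumes x: "full_descent x" and "v \<in> lists S" "reduced v"
  shows "len (v @ x) + len v = len x"
  using assms(2,3)
proof (induction v rule: list.induct)
  case (Cons s v)
  have s: "s \<in> S" "v \<in> lists S" and red: "reduced v"
    using Cons.prems reduced_append(2)[of "[s]" v] by simp_all
  have "0 \<le> wact v (simple_root s) y" for y
    using Cons.prems(2) s red by (intro root_nonneg) simp_all
  moreover have "wact v (simple_root s) y = 0" if "y \<notin> S" for y
    using that s by (intro wact_supported[OF s(2)]) (auto simp: simple_root_def)
  ultimately have "wact (v @ x) (simple_root s) y \<le> 0" for y
    using full_descent_nonpos[OF x] by simp
  moreover have "v @ x \<in> lists S" using s x unfolding full_descent_def by simp
  ultimately have "len (s # v @ x) < len (v @ x)" using len_Cons_less_iff' s(1) by blast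
  then have "len (v @ x) = Suc (len (s # v @ x))" using len_Cons[OF s(1), of "v @ x"] by linarith
  then show ?case using Cons.IH[OF s(2) red] Cons.prems(2) red by simp
qed simp

lemma rev_in_lists: "rev w \<in> lists S \<longleftrightarrow> w \<in> lists S"
  by (auto simp: in_lists_conv_set)

lemma full_descent_maximal:
  assumes "full_descent x" "w \<in> lists S" shows "len w \<le> len x"
proof -
  obtain v where v: "v \<approx> w" "length v = len w" using len_ex .
  have "len v = len w" using len_cong[OF v(1)] .
  moreover have "v \<in> lists S" using cox_eq_lists[OF v(1)] assms(2) by simp
  ultimately show ?thesis using len_append_full_descent[OF assms(1), of v] v(2) by simp
qed

lemma full_descent_if_maximal:
  assumes "x \<in> lists S" "\<And>w. w \<in> lists S \<Longrightarrow> len w \<le> len x"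
  shows "full_descent x"
  unfolding full_descent_def
proof (intro conjI ballI)
  fix s assume "s \<in> S"
  then show "len (s # x) < len x" using assms(2)[of "s # x"] assms(1) len_Cons[of s x] by auto
qed (rule assms(1))

lemma len_0_iff: "len w = 0 \<longleftrightarrow> w \<approx> []"
proof
  assume "len w = 0"
  moreover obtain v where "v \<approx> w" "length v = len w" using len_ex .
  ultimately have "[] \<approx> w" by simp
  then show "w \<approx> []" by (rule thue_sym)
qed (use len_cong in fastforce)

text \<open>The reversal of \<open>y\<close> represents its inverse, and by the previous length
  formula the product of that inverse with \<open>x\<close> has length zero.\<close>

lemma full_descent_unique:
  assumes x: "full_descent x" and y: "y \<in> lists S" "reduced y" "len y = len x"
  shows "x \<approx> y"
proof -
  have "len (rev y @ x) + len (rev y) = len x"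
    using y by (intro len_append_full_descent[OF x]) (simp_all add: rev_in_lists)
  then have "rev y @ x \<approx> []" using y(3) len_0_iff by simp
  then have 1: "y @ rev y @ x \<approx> y" using thue_append[of cox_rels y y "rev y @ x" "[]"] by simp
  have "y @ rev y \<approx> []" using cox_rev_cancel[of "rev y"] y(1) by (simp add: rev_in_lists)
  from thue_append[OF this thue_refl[of _ x]] have "y @ rev y @ x \<approx> x" by simp
  then show ?thesis using 1 by (rule thue_trans[OF thue_sym])
qed

text \<open>Deleting \<open>s\<close> from the front leaves a word \<open>y\<close> that is not
  longest, so some \<open>t\<close> lengthens it on the right, and uniqueness identifies the result
  with \<open>x\<close>. Matsumoto's theorem turns these equalities into braid equalities.\<close>

lemma full_descent_Cons_snoc:
  assumes x: "full_descent x" "reduced x" and s: "s \<in> S"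
  obtains y t where "y \<in> lists S" "t \<in> S" "x \<sim> s # y" "x \<sim> y @ [t]"
proof -
  have xS: "x \<in> lists S" and "len (s # x) < len x" using x(1) s unfolding full_descent_def by auto
  obtain y where y: "y \<approx> s # x" "length y = len (s # x)" using len_ex .
  have leny: "Suc (length y) = len x" using y(2) len_Cons[OF s, of x] \<open>len (s # x) < len x\<close> by simp
  have yS: "y \<in> lists S" using cox_eq_lists[OF y(1)] xS s by simp
  have redy: "reduced y" using len_cong[OF y(1)] y(2) by simp
  have "s # y \<approx> s # s # x" using thue_Cons[OF y(1)] .
  also have "s # s # x \<approx> x" using cox_square[OF s] .
  finally have sy: "s # y \<approx> x" .
  have "reduced (s # y)" using len_cong[OF sy] leny by simp
  from matsumoto[OF x(2) this xS thue_sym[OF sy]] have 1: "x \<sim> s # y" .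
  have "\<not> full_descent (rev y)"
  proof
    assume "full_descent (rev y)"
    then have "len x \<le> len (rev y)" using full_descent_maximal xS by blast
    then show False using redy leny by simp
  qed
  then obtain t where t: "t \<in> S" "\<not> len (t # rev y) < len (rev y)"
    using yS unfolding full_descent_def by (auto simp: rev_in_lists)
  have "len (t # rev y) = Suc (len (rev y))" using len_Cons[OF t(1), of "rev y"] t(2) by linarith
  then have lyt: "len (y @ [t]) = Suc (len y)" using len_rev[of "y @ [t]"] by simp
  then have redyt: "reduced (y @ [t])" using redy by simp
  have ytS: "y @ [t] \<in> lists S" using yS t(1) by simp
  have "x \<approx> y @ [t]" using full_descent_unique[OF x(1) ytS redyt] lyt redy leny by simp
  from matsumoto[OF x(2) redyt xS this] have "x \<sim> y @ [t]" .
  with that yS t(1) 1 show thesis by blast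
qed

text \<open>Conjugation by the longest element permutes the generators. The permutation is an
  involution because the longest element is its own inverse.\<close>

lemma full_descent_twist:
  assumes x: "full_descent x" "reduced x" and s: "s \<in> S"
  obtains t where "t \<in> S" "s # x \<sim> x @ [t]" "t # x \<sim> x @ [s]"
proof -
  have ex: "\<exists>t\<in>S. s # x \<sim> x @ [t]" if "s \<in> S" for s
  proof -
    from full_descent_Cons_snoc[OF x that]
    obtain y t where y: "y \<in> lists S" "t \<in> S" "x \<sim> s # y" "x \<sim> y @ [t]" .
    have "s # x \<sim> s # y @ [t]" using thue_Cons[OF y(4)] .
    moreover have "s # y @ [t] \<sim> x @ [t]" using thue_append[OF thue_sym[OF y(3)] thue_refl] by simp
    ultimately show ?thesis using y(2) thue_trans by blast
  qed
  obtain t where t: "t \<in> S" "s # x \<sim> x @ [t]" using ex[OF s] by blast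
  obtain s' where s': "s' \<in> S" "t # x \<sim> x @ [s']" using ex[OF t(1)] by blast
  have xS: "x \<in> lists S" using x(1) unfolding full_descent_def by blast
  \<comment> \<open>The Coxeter group is needed only to identify \<open>s'\<close> with
    \<open>s\<close>: reversing the relation for \<open>s\<close> gives the one for \<open>t\<close>
    with \<open>s\<close> in place of \<open>s'\<close>.\<close>
  have xr: "x \<approx> rev x" using x by (intro full_descent_unique) (simp_all add: rev_in_lists xS)
  have "t # x \<approx> t # rev x" using thue_Cons[OF xr] .
  also have "t # rev x \<approx> rev x @ [s]" using braid_imp_cox[OF braid_eq_rev[OF thue_sym[OF t(2)]]] by simp
  also have "rev x @ [s] \<approx> x @ [s]" using thue_append[OF thue_sym[OF xr] thue_refl] .
  finally have "x @ [s'] \<approx> x @ [s]"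
    by (rule thue_trans[OF thue_sym[OF braid_imp_cox[OF s'(2)]]])
  then have 1: "rev x @ x @ [s'] \<approx> rev x @ x @ [s]" by (rule thue_append[OF thue_refl])
  have 2: "rev x @ x @ [r] \<approx> [r]" for r
    using thue_append[OF cox_rev_cancel[OF xS] thue_refl[of _ "[r]"]] by simp
  from thue_trans[OF thue_trans[OF thue_sym[OF 2] 1] 2]  have "s' = s" by (rule cox_letters_eq[OF s'(1) s])
  then show thesis using that t s'(2) by blast
qed

section \<open>Powers of a generator\<close>

lemma replicate_in_lists: "t \<in> S \<Longrightarrow> replicate n t \<in> lists S"
  by (induction n) simp_all

text \<open>The word on the left is the least common multiple of \<open>s\<close> and
  \<open>t\<close> spelled with last letter \<open>t\<close>. Its other spelling consists of a first
  letter, depending on the parity, followed by the same alternating word.\<close>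

lemma alt_word_shift:
  assumes st: "s \<in> S" "t \<in> S" and m: "m t s = enat (Suc n)"
  shows "\<exists>r\<in>S. rev (alt_word n s t) @ [t] \<sim> r # rev (alt_word n s t)"
proof (cases "even n")
  case True
  have "rev (alt_word n s t) @ [t] = alt_word (Suc n) t s" 
    using True by (subst alt_word_Suc_right) (simp add: rev_alt_word)
  moreover have "alt_word (Suc n) t s \<sim> alt_word (Suc n) s t" using braid_rel[OF st(2,1) m] .
  ultimately show ?thesis using True st by (intro bexI[of _ s]) (simp_all add: rev_alt_word)
next
  case False
  have "rev (alt_word n s t) @ [t] = alt_word (Suc n) s t"
    using False by (subst alt_word_Suc_right) (simp add: rev_alt_word)
  moreover have "alt_word (Suc n) s t \<sim> alt_word (Suc n) t s"
    using thue_sym[OF braid_rel[OF st(2,1) m]] .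
  ultimately show ?thesis using False st by (intro bexI[of _ t]) (simp_all add: rev_alt_word)
qed

text \<open>A multiple of both \<open>t\<close> and \<open>u\<close> ends in their least common
  multiple. Removing the final \<open>t\<close> leaves a word that again ends in \<open>u\<close>,
  so the powers of \<open>t\<close> go one at a time.\<close>

lemma right_divisor_of_power:
  assumes "w \<in> lists S" "t \<in> S" "u \<noteq> t" "w @ replicate (Suc j) t \<sim> x @ [u]"
  shows "\<exists>n c. m t u = enat (Suc n) \<and> 0 < n \<and> w \<sim> c @ rev (alt_word n u t)"
  using assms(4)
proof (induction j arbitrary: x)
  case (0 x)
  have wt: "w @ [t] \<in> lists S" using assms by simp
  have "w @ [t] \<sim> x @ [u]" using 0 by simp
  from common_right_divisor[OF wt this]
  obtain n c where n: "m t u = enat (Suc n)" and w: "w \<sim> c @ rev (alt_word n u t)" .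
  have "x @ [u] \<in> lists S" using braid_eq_lists[OF 0] assms(1,2) by simp
  then have "n \<noteq> 0" using m_enat_ge_2[OF assms(2) _ _ n] assms(3) by auto
  then show ?case using n w by auto
next
  case (Suc j x)
  have rS: "w @ replicate (Suc j) t \<in> lists S" 
    using assms(1) replicate_in_lists[OF assms(2), of "Suc j"] by simp
  have eq: "(w @ replicate (Suc j) t) @ [t] \<sim> x @ [u]"
    using Suc.prems by (simp add: replicate_append_same)
  have "(w @ replicate (Suc j) t) @ [t] \<in> lists S" using rS assms(2) by simp
  from common_right_divisor[OF this eq]
  obtain n c where n: "m t u = enat (Suc n)" and w: "w @ replicate (Suc j) t \<sim> c @ rev (alt_word n u t)" .
  have "x @ [u] \<in> lists S" using braid_eq_lists[OF eq] rS assms(2) by simp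
  then have "n \<noteq> 0" using m_enat_ge_2[OF assms(2) _ _ n] assms(3) by auto
  then obtain k where "n = Suc k" using not0_implies_Suc by blast
  \<comment> \<open>Here n > 0, which follows from \<open>m t u\<close> being at least 2, provides
    the last letter \<open>u\<close>.\<close>
  then have "w @ replicate (Suc j) t \<sim> (c @ rev (alt_word k t u)) @ [u]" using w by simp
  then show ?case by (rule Suc.IH)
qed

lemma conjugator_reduction:
  assumes w: "w \<in> lists S" and t: "t \<in> S" and n: "n \<noteq> 0"
    and x: "w @ replicate n t \<sim> x @ [u]" and y: "w \<sim> y @ [u]"
  obtains e X r where "w \<sim> e @ X" "X \<noteq> []" "r \<in> S" "X @ [t] \<sim> r # X"
proof (cases "u = t")
  case True
  \<comment> \<open>Here \<open>X\<close> is the single letter \<open>t\<close>, which commutes with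
    itself.\<close>
  show thesis by (rule that[OF y _ t]) (simp_all add: True)
next
  case False
  obtain j where j: "n = Suc j" using n not0_implies_Suc by blast
  from right_divisor_of_power[OF w t False] x j
  obtain k c where k: "m t u = enat (Suc k)" "0 < k" "w \<sim> c @ rev (alt_word k u t)" by blast
  have "u \<in> S" using braid_eq_lists[OF y] w by simp
  from alt_word_shift[OF this t k(1)]
  obtain r where r: "r \<in> S" "rev (alt_word k u t) @ [t] \<sim> r # rev (alt_word k u t)" by blast
  have "length (rev (alt_word k u t)) > 0" using k(2) by simp
  then show thesis using that[OF k(3) _ r] by blast
qed

lemma shift_power:
  assumes "X @ [t] \<sim> r # X" shows "X @ replicate n t \<sim> replicate n r @ X"
proof (induction n)
  case (Suc n)
  have "(X @ [t]) @ replicate n t \<sim> [r] @ X @ replicate n t"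
    using thue_append[OF assms thue_refl[of _ "replicate n t"]] by simp
  also have "[r] @ X @ replicate n t \<sim> [r] @ replicate n r @ X"
    using thue_append[OF thue_refl Suc] .
  finally show ?case by simp
qed simp

end

section \<open>Finite Coxeter groups: the longest element and its central square\<close>

locale spherical_coxeter_system = coxeter_system +
  assumes spherical: "spherical_type S m"
begin

text \<open>Signs can be forgotten because generators are involutions modulo
  \<open>cox_rels\<close>.\<close>

lemma pres_cong_imp_cox_eq: "(u, v) \<in> pres_cong S cox_rels \<Longrightarrow> map fst u \<approx> map fst v"
proof (induction rule: pres_cong.induct)
  case (cancel u v s e)
  then show ?case using thue_append[OF thue_refl cox_square] by simp
next
  case (rel u v l r)
  have "map fst (pos_word w) = w" for w :: "'a list" by (simp add: pos_word_def comp_def)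
  then show ?case using thue_context[OF thue_rel[OF rel(3)]] by simp
qed (auto intro: thue_sym thue_trans)

text \<open>The length depends only on the class in the finite Coxeter group, so it can be read off
  from any chosen representative of the class.\<close>

lemma finite_len: "finite (len ` lists S)"
proof (rule finite_subset)
  let ?C = "carrier (coxeter_group S m)" and ?g = "\<lambda>C. len (map fst (SOME x. x \<in> C))"
  show "finite (?g ` ?C)" using spherical unfolding spherical_type_def by simp
  show "len ` lists S \<subseteq> ?g ` ?C"
  proof
    fix n assume "n \<in> len ` lists S"
    then obtain w where w: "w \<in> lists S" "n = len w" by blast
    let ?D = "pres_cong S cox_rels `` {pos_word w}"
    have pw: "pos_word w \<in> signed_words S" using pos_word_signed[OF w(1)] .
    then have "pos_word w \<in> ?D" by (auto intro: pres_cong.refl)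
    then have "(SOME x. x \<in> ?D) \<in> ?D" by (rule someI)
    then have "map fst (pos_word w) \<approx> map fst (SOME x. x \<in> ?D)"
      using pres_cong_imp_cox_eq by blast
    then have "?g ?D = n" using len_cong w(2) by (auto simp: pos_word_def comp_def)
    moreover have "?D \<in> ?C"
      using pw by (auto simp: coxeter_group_def pres_group_def quotient_def)
    ultimately show "n \<in> ?g ` ?C" by blast
  qed
qed

lemma ex_longest:
  obtains x where "full_descent x" "reduced x"
proof -
  have "Max (len ` lists S) \<in> len ` lists S"
    by (rule Max_in[OF finite_len]) auto
  then obtain w where w: "w \<in> lists S" "len w = Max (len ` lists S)" by (metis imageE)
  obtain x where x: "x \<approx> w" "length x = len w" using len_ex .
  have lx: "len x = len w" using len_cong[OF x(1)] .
  have "x \<in> lists S" using cox_eq_lists[OF x(1)] w(1) by simp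
  moreover have "len v \<le> len x" if "v \<in> lists S" for v
    using Max_ge[OF finite_len] that w(2) lx by simp
  ultimately have "full_descent x" by (rule full_descent_if_maximal)
  then show thesis using that x(2) lx by simp
qed

text \<open>The square of the longest element works: passing a letter through one copy permutes the
  generators by an involution, so passing through two copies restores it.\<close>

lemma ex_central_common_multiple:
  "\<exists>Z\<in>lists S. \<exists>c. (\<forall>w\<in>lists S. w @ Z \<sim> Z @ w) \<and>
    (\<forall>s\<in>S. c s \<in> lists S \<and> s # c s \<sim> Z \<and> c s @ [s] \<sim> Z)"
proof -
  obtain x where x: "full_descent x" "reduced x" using ex_longest .
  have xS: "x \<in> lists S" using x(1) unfolding full_descent_def by blast
  define Z where "Z = x @ x"
  have ZS: "Z \<in> lists S" using xS by (simp add: Z_def)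
  have letter: "s # Z \<sim> Z @ [s]" if "s \<in> S" for s
  proof -
    from full_descent_twist[OF x that] obtain t where t: "s # x \<sim> x @ [t]" "t # x \<sim> x @ [s]" .
    have "s # x @ x \<sim> x @ t # x" using thue_append[OF t(1) thue_refl[of _ x]] by simp
    also have "x @ t # x \<sim> x @ x @ [s]" using thue_append[OF thue_refl t(2)] .
    finally show ?thesis by (simp add: Z_def)
  qed
  have central: "w @ Z \<sim> Z @ w" if "w \<in> lists S" for w
    using that
  proof (induction w rule: list.induct)
    case (Cons s w)
    have "s # w @ Z \<sim> s # Z @ w" using Cons by (intro thue_Cons) simp
    also have "s # Z @ w \<sim> Z @ s # w" using thue_append[OF letter thue_refl[of _ w]] Cons by simp
    finally show ?case by simp
  qed simp
  have "\<exists>c\<in>lists S. s # c \<sim> Z \<and> c @ [s] \<sim> Z" if s: "s \<in> S" for s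
  proof -
    from full_descent_Cons_snoc[OF x s] obtain y where y: "y \<in> lists S" "x \<sim> s # y" .
    define c where "c = y @ x"
    have cS: "c \<in> lists S" using y(1) xS by (simp add: c_def)
    have sc: "s # c \<sim> Z" using thue_append[OF thue_sym[OF y(2)] thue_refl[of _ x]] by (simp add: c_def Z_def)
    \<comment> \<open>Centrality and left cancellation make the right complement of \<open>s\<close>
      also a left complement.\<close>
    have "[s] @ c @ [s] \<sim> Z @ [s]" using thue_append[OF sc thue_refl[of _ "[s]"]] by simp
    also have "Z @ [s] \<sim> [s] @ Z" using thue_sym[OF letter[OF s]] by simp
    finally have "c @ [s] \<sim> Z" by (rule braid_cancel_left[rotated]) (use s cS in simp)
    then show ?thesis using cS sc by blast
  qed
  then obtain c where "\<And>s. s \<in> S \<Longrightarrow> c s \<in> lists S \<and> s # c s \<sim> Z \<and> c s @ [s] \<sim> Z" by metis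
  then show ?thesis using ZS central by blast
qed

section \<open>The embedding of positive braids in the Artin-Tits group\<close>

text \<open>An inverse generator is replaced by its complement in the central element \<open>Z\<close>, and
  the number of such letters records the missing power of \<open>Z\<close>.\<close>

theorem pres_cong_imp_braid_eq:
  assumes "(pos_word a, pos_word b) \<in> pres_cong S (braid_rels S m)"
  shows "a \<sim> b"
proof -
  obtain Z c where Z: "Z \<in> lists S" and central: "\<And>w. w \<in> lists S \<Longrightarrow> w @ Z \<sim> Z @ w"
    and c: "\<And>s. s \<in> S \<Longrightarrow> c s \<in> lists S" "\<And>s. s \<in> S \<Longrightarrow> s # c s \<sim> Z" "\<And>s. s \<in> S \<Longrightarrow> c s @ [s] \<sim> Z"
    using ex_central_common_multiple by blast
  define psi where "psi w = concat (map (\<lambda>(s, e). if e then [s] else c s) w)" for w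
  define neg where "neg w = length (filter (\<lambda>x. \<not> snd x) w)" for w :: "('a \<times> bool) list"
  define zp where "zp n = concat (replicate n Z)" for n
  have zp_add: "zp (n + k) = zp n @ zp k" for n k by (simp add: zp_def replicate_add)
  have zpS: "zp n \<in> lists S" for n using Z by (induction n) (simp_all add: zp_def)
  have psi_Cons: "psi [] = []" "psi (x # w) = (if snd x then [fst x] else c (fst x)) @ psi w" for x w
    by (simp_all add: psi_def case_prod_beta)
  have psiS: "psi w \<in> lists S" if "w \<in> signed_words S" for w
    using that
  proof (induction w)
    case (Cons x w)
    then have "(if snd x then [fst x] else c (fst x)) \<in> lists S" "psi w \<in> lists S"
      using c(1) by simp_all
    then show ?case unfolding psi_Cons by simp
  qed (simp add: psi_Cons)
  have psi_app: "psi (u @ v) = psi u @ psi v" and neg_app: "neg (u @ v) = neg u + neg v" for u v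
    by (simp_all add: psi_def neg_def)
  have pos: "psi (pos_word w) = w" "neg (pos_word w) = 0" for w
    by (induction w) (simp_all add: psi_def neg_def pos_word_def)
  \<comment> \<open>Congruent signed words give the same fraction of \<open>psi\<close> by a power
    of \<open>Z\<close>; cross-multiplication keeps the claim inside positive words.\<close>
  have "psi u @ zp (neg v) \<sim> psi v @ zp (neg u)" if "(u, v) \<in> pres_cong S (braid_rels S m)" for u v
    using that
  proof (induction rule: pres_cong.induct)
    case (sym u v)
    then show ?case by (intro thue_sym[of _ "psi u @ zp (neg v)"])
  next
    case (trans u v w)
    have S: "u \<in> signed_words S" using pres_cong_signed[OF braid_rels_lists trans(1)] by simp
    \<comment> \<open>As for equality of fractions, transitivity holds after multiplication by the
      middle denominator, which right cancellation removes.\<close>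
    have "(psi u @ zp (neg w)) @ zp (neg v) = (psi u @ zp (neg v)) @ zp (neg w)"
      using zp_add[of "neg w" "neg v"] zp_add[of "neg v" "neg w"] by (simp add: add.commute)
    also have "(psi u @ zp (neg v)) @ zp (neg w) \<sim> (psi v @ zp (neg u)) @ zp (neg w)"
      using thue_append[OF trans(3) thue_refl] .
    also have "(psi v @ zp (neg u)) @ zp (neg w) = (psi v @ zp (neg w)) @ zp (neg u)"
      using zp_add[of "neg w" "neg u"] zp_add[of "neg u" "neg w"] by (simp add: add.commute)
    also have "(psi v @ zp (neg w)) @ zp (neg u) \<sim> (psi w @ zp (neg v)) @ zp (neg u)"
      using thue_append[OF trans(4) thue_refl] .
    also have "(psi w @ zp (neg v)) @ zp (neg u) = (psi w @ zp (neg u)) @ zp (neg v)"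
      using zp_add[of "neg v" "neg u"] zp_add[of "neg u" "neg v"] by (simp add: add.commute)
    finally show ?case
      by (rule braid_cancel_right[rotated]) (simp add: psiS[OF S] zpS)
  next
    case (cancel u v s e)
    let ?x = "[(s, e), (s, \<not> e)]" and ?n = "neg u + neg v"
    \<comment> \<open>The cancelling pair becomes one copy of \<open>Z\<close> in either order,
      since complements are two-sided; it matches the single inverse letter counted by
      \<open>neg\<close>.\<close>
    have "psi ?x \<sim> Z" using c(2,3)[OF cancel(3)] by (cases e) (simp_all add: psi_def)
    moreover have "neg ?x = 1" by (simp add: neg_def)
    moreover have "psi v @ Z @ zp ?n \<sim> Z @ psi v @ zp ?n"
      using thue_append[OF central[OF psiS[OF cancel(2)]] thue_refl[of _ "zp ?n"]] by simp
    ultimately have "psi u @ psi ?x @ psi v @ zp ?n \<sim> psi u @ psi v @ Z @ zp ?n"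
      using thue_trans[OF thue_context thue_append[OF thue_refl thue_sym]] by blast
    moreover have "zp (Suc ?n) = Z @ zp ?n" by (simp add: zp_def)
    ultimately show ?case
      using \<open>neg ?x = 1\<close> by (simp add: psi_app neg_app del: append_Cons)
  next
    case (rel u v l r)
    have "psi u @ l @ psi v \<sim> psi u @ r @ psi v" using thue_context[OF thue_rel[OF rel(3)]] .
    from thue_append[OF this thue_refl[of _ "zp (neg u + neg v)"]]
    show ?case by (simp add: psi_app neg_app pos)
  qed simp
  from this[OF assms] show ?thesis by (simp add: pos zp_def)
qed

section \<open>Positive words and conjugation inside the Artin-Tits group\<close>

abbreviation G where "G \<equiv> artin_group S m"

definition cls :: "'a list \<Rightarrow> ('a \<times> bool) list set" where
  "cls w = pres_cong S (braid_rels S m) `` {pos_word w}"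

interpretation G: group G by (rule group_artin_group)

lemma cls_closed [simp]: "w \<in> lists S \<Longrightarrow> cls w \<in> carrier G"
  by (simp add: cls_def artin_group_def pres_group_def quotientI pos_word_signed del: in_lists_conv_set)

lemma cls_append: "u \<in> lists S \<Longrightarrow> v \<in> lists S \<Longrightarrow> cls (u @ v) = cls u \<otimes>\<^bsub>G\<^esub> cls v"
  using pres_group_mult_class[OF braid_rels_lists pos_word_signed pos_word_signed, of u v]
  by (simp add: cls_def artin_group_def del: in_lists_conv_set)

lemma cls_Nil: "cls [] = \<one>\<^bsub>G\<^esub>"
  by (simp add: cls_def artin_group_def pres_group_def pos_word_def)

lemma artin_gen_eq: "artin_gen S m s = cls [s]"
  by (simp add: artin_gen_def pres_gen_def cls_def pos_word_def)

lemma cls_eq_iff: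
  assumes "u \<in> lists S" shows "cls u = cls v \<longleftrightarrow> u \<sim> v"
proof
  assume "u \<sim> v"
  then show "cls u = cls v"
    unfolding cls_def using assms
    by (intro equiv_class_eq[OF equiv_pres_cong[OF braid_rels_lists]]
        thue_imp_pres_cong braid_rels_lists)
next
  assume "cls u = cls v"
  then have "(pos_word v, pos_word u) \<in> pres_cong S (braid_rels S m)"
    unfolding cls_def using pres_cong.refl[OF pos_word_signed[OF assms], of "braid_rels S m"] by blast
  then show "u \<sim> v" using pres_cong_imp_braid_eq thue_sym by blast
qed

lemma artin_monoid_eq: "artin_monoid S m = cls ` lists S"
proof (intro equalityI subsetI)
  fix a assume "a \<in> artin_monoid S m"
  then show "a \<in> cls ` lists S"
  proof (induction rule: artin_monoid.induct)
    case one
    show ?case using cls_Nil by (intro image_eqI[of _ _ "[]"]) simp_all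
  next
    case (gen s)
    then show ?case using artin_gen_eq by (intro image_eqI[of _ _ "[s]"]) simp_all
  next
    case (mult a b)
    then obtain u v where "u \<in> lists S" "v \<in> lists S" "a = cls u" "b = cls v" by blast
    then show ?case using cls_append by (intro image_eqI[of _ _ "u @ v"]) simp_all
  qed
next
  fix a assume "a \<in> cls ` lists S"
  then obtain w where "w \<in> lists S" "a = cls w" by blast
  moreover have "cls w \<in> artin_monoid S m" if "w \<in> lists S" for w
    using that
  proof (induction w rule: list.induct)
    case Nil
    show ?case using artin_monoid.one by (simp add: cls_Nil)
  next
    case (Cons s w)
    then show ?case using cls_append[of "[s]" w] artin_monoid.mult[OF artin_monoid.gen[of s S m], of "cls w"] Cons
      by (simp add: artin_gen_eq)
  qed
  ultimately show "a \<in> artin_monoid S m" by blast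
qed

lemma artin_group_induct [consumes 1, case_names one gen inv]:
  assumes "g \<in> carrier G" and "P \<one>\<^bsub>G\<^esub>"
    and "\<And>s g. s \<in> S \<Longrightarrow> g \<in> carrier G \<Longrightarrow> P g \<Longrightarrow> P (cls [s] \<otimes>\<^bsub>G\<^esub> g)"
    and "\<And>s g. s \<in> S \<Longrightarrow> g \<in> carrier G \<Longrightarrow> P g \<Longrightarrow> P (inv\<^bsub>G\<^esub> cls [s] \<otimes>\<^bsub>G\<^esub> g)"
  shows "P g"
proof -
  let ?K = "\<lambda>w. pres_cong S (braid_rels S m) `` {w}"
  have K: "?K w \<in> carrier G" if "w \<in> signed_words S" for w
    using that by (auto simp: artin_group_def pres_group_def quotient_def)
  have mult: "?K (u @ v) = ?K u \<otimes>\<^bsub>G\<^esub> ?K v" if "u \<in> signed_words S" "v \<in> signed_words S" for u v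
    using pres_group_mult_class[OF braid_rels_lists that] by (simp add: artin_group_def)
  have "P (?K w)" if "w \<in> signed_words S" for w
    using that
  proof (induction w)
    case Nil
    then show ?case using assms(2) by (simp add: artin_group_def pres_group_def)
  next
    case (Cons x w)
    obtain s e where x: "x = (s, e)" by fastforce
    have s: "s \<in> S" and w: "w \<in> signed_words S" using Cons.prems x by simp_all
    have split: "?K (x # w) = ?K [(s, e)] \<otimes>\<^bsub>G\<^esub> ?K w" using mult[of "[(s, e)]" w] s w x by simp
    show ?case
    proof (cases e)
      case True
      then have "?K [(s, e)] = cls [s]" by (simp add: cls_def pos_word_def)
      then show ?thesis using split assms(3)[OF s K[OF w]] Cons.IH w by simp
    next
      case False
      have "([(s, False), (s, True)], []) \<in> pres_cong S (braid_rels S m)"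
        using pres_cong.cancel[of "[]" S "[]" s False] s by simp
      then have "?K [(s, False), (s, True)] = ?K []"
        by (rule equiv_class_eq[OF equiv_pres_cong[OF braid_rels_lists]])
      then have "?K [(s, False)] \<otimes>\<^bsub>G\<^esub> cls [s] = \<one>\<^bsub>G\<^esub>"
        using mult[of "[(s, False)]" "[(s, True)]"] s
        by (simp add: cls_def pos_word_def artin_group_def pres_group_def)
      then have "?K [(s, False)] = inv\<^bsub>G\<^esub> cls [s]"
        using G.inv_equality[of _ "cls [s]"] K[of "[(s, False)]"] s by simp
      then show ?thesis using False split assms(4)[OF s K[OF w]] Cons.IH w by simp
    qed
  qed
  moreover obtain w where "w \<in> signed_words S" "g = ?K w"
    using assms(1) by (auto simp: artin_group_def pres_group_def quotient_def)
  ultimately show ?thesis by blast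
qed

text \<open>Conjugation by \<open>inv cls [s]\<close> equals conjugation by the positive complement
  of \<open>s\<close> in the central element, because conjugation by \<open>cls Z\<close> is
  trivial.\<close>

lemma conj_by_positive:
  assumes "g \<in> carrier G"
  obtains b where "b \<in> lists S"
    "\<And>x. x \<in> carrier G \<Longrightarrow> g \<otimes>\<^bsub>G\<^esub> x \<otimes>\<^bsub>G\<^esub> inv\<^bsub>G\<^esub> g = cls b \<otimes>\<^bsub>G\<^esub> x \<otimes>\<^bsub>G\<^esub> inv\<^bsub>G\<^esub> cls b"
proof -
  obtain Z c where Z: "Z \<in> lists S" and central: "\<And>w. w \<in> lists S \<Longrightarrow> w @ Z \<sim> Z @ w"
    and c: "\<And>s. s \<in> S \<Longrightarrow> c s \<in> lists S" "\<And>s. s \<in> S \<Longrightarrow> s # c s \<sim> Z" "\<And>s. s \<in> S \<Longrightarrow> c s @ [s] \<sim> Z"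
    using ex_central_common_multiple by blast
  have comm: "cls w \<otimes>\<^bsub>G\<^esub> cls Z = cls Z \<otimes>\<^bsub>G\<^esub> cls w" if "w \<in> lists S" for w
    using cls_eq_iff[of "w @ Z" "Z @ w"] central[OF that] that Z by (simp add: cls_append)
  \<comment> \<open>Commuting with the generators and their inverses extends \<open>comm\<close>
    from positive elements to the whole group.\<close>
  have central_G: "h \<otimes>\<^bsub>G\<^esub> cls Z = cls Z \<otimes>\<^bsub>G\<^esub> h" if "h \<in> carrier G" for h
    using that
  proof (induction rule: artin_group_induct)
    case one
    show ?case using Z by simp
  next
    case (gen s h)
    then show ?case using comm[of "[s]"] Z by (metis G.m_assoc cls_closed lists.Cons lists.Nil)
  next
    case (inv s h)
    have "inv\<^bsub>G\<^esub> cls [s] \<otimes>\<^bsub>G\<^esub> cls Z = cls Z \<otimes>\<^bsub>G\<^esub> inv\<^bsub>G\<^esub> cls [s]"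
      using comm[of "[s]"] inv(1) Z
      by (metis G.inv_closed G.inv_solve_left G.inv_solve_right G.m_assoc G.m_closed cls_closed lists.Cons lists.Nil)
    then show ?case using inv Z by (metis G.m_assoc cls_closed lists.Cons lists.Nil G.inv_closed)
  qed
  have "\<exists>b\<in>lists S. \<forall>x\<in>carrier G. g \<otimes>\<^bsub>G\<^esub> x \<otimes>\<^bsub>G\<^esub> inv\<^bsub>G\<^esub> g = cls b \<otimes>\<^bsub>G\<^esub> x \<otimes>\<^bsub>G\<^esub> inv\<^bsub>G\<^esub> cls b"
    using assms
  proof (induction rule: artin_group_induct)
    case one
    show ?case by (intro bexI[of _ "[]"]) (simp_all add: cls_Nil)
  next
    case (gen s h)
    then obtain b where b: "b \<in> lists S" "\<And>x. x \<in> carrier G \<Longrightarrow> h \<otimes>\<^bsub>G\<^esub> x \<otimes>\<^bsub>G\<^esub> inv\<^bsub>G\<^esub> h = cls b \<otimes>\<^bsub>G\<^esub> x \<otimes>\<^bsub>G\<^esub> inv\<^bsub>G\<^esub> cls b"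
      by blast
    have "cls [s] \<otimes>\<^bsub>G\<^esub> h \<otimes>\<^bsub>G\<^esub> x \<otimes>\<^bsub>G\<^esub> inv\<^bsub>G\<^esub> (cls [s] \<otimes>\<^bsub>G\<^esub> h) =
        cls ([s] @ b) \<otimes>\<^bsub>G\<^esub> x \<otimes>\<^bsub>G\<^esub> inv\<^bsub>G\<^esub> cls ([s] @ b)" if x: "x \<in> carrier G" for x
    proof -
      have "cls [s] \<otimes>\<^bsub>G\<^esub> h \<otimes>\<^bsub>G\<^esub> x \<otimes>\<^bsub>G\<^esub> inv\<^bsub>G\<^esub> (cls [s] \<otimes>\<^bsub>G\<^esub> h) =
          cls [s] \<otimes>\<^bsub>G\<^esub> (h \<otimes>\<^bsub>G\<^esub> x \<otimes>\<^bsub>G\<^esub> inv\<^bsub>G\<^esub> h) \<otimes>\<^bsub>G\<^esub> inv\<^bsub>G\<^esub> cls [s]"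
        using gen x by (simp add: G.inv_mult_group G.m_assoc)
      also have "\<dots> = cls ([s] @ b) \<otimes>\<^bsub>G\<^esub> x \<otimes>\<^bsub>G\<^esub> inv\<^bsub>G\<^esub> cls ([s] @ b)"
        unfolding b(2)[OF x] using gen(1) x b(1)
        by (subst (1 2) cls_append) (simp_all add: G.inv_mult_group G.m_assoc)
      finally show ?thesis .
    qed
    then show ?case using gen(1) b(1) by (intro bexI[of _ "[s] @ b"]) simp_all
  next
    case (inv s h)
    then obtain b where b: "b \<in> lists S" "\<And>x. x \<in> carrier G \<Longrightarrow> h \<otimes>\<^bsub>G\<^esub> x \<otimes>\<^bsub>G\<^esub> inv\<^bsub>G\<^esub> h = cls b \<otimes>\<^bsub>G\<^esub> x \<otimes>\<^bsub>G\<^esub> inv\<^bsub>G\<^esub> cls b"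
      by blast
    have sG: "cls [s] \<in> carrier G" "cls (c s) \<in> carrier G" "cls Z \<in> carrier G"
      using inv(1) c(1) Z by simp_all
    have "cls (c s) \<otimes>\<^bsub>G\<^esub> cls [s] = cls Z"
      using cls_eq_iff[of "c s @ [s]" Z] c(1,3) inv(1) by (simp add: cls_append)
    then have cs: "cls (c s) = cls Z \<otimes>\<^bsub>G\<^esub> inv\<^bsub>G\<^esub> cls [s]"
      using sG G.inv_solve_right by metis
    have "inv\<^bsub>G\<^esub> cls [s] \<otimes>\<^bsub>G\<^esub> h \<otimes>\<^bsub>G\<^esub> x \<otimes>\<^bsub>G\<^esub> inv\<^bsub>G\<^esub> (inv\<^bsub>G\<^esub> cls [s] \<otimes>\<^bsub>G\<^esub> h) =
        cls (c s @ b) \<otimes>\<^bsub>G\<^esub> x \<otimes>\<^bsub>G\<^esub> inv\<^bsub>G\<^esub> cls (c s @ b)" if x: "x \<in> carrier G" for x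
    proof -
      define y where "y = cls b \<otimes>\<^bsub>G\<^esub> x \<otimes>\<^bsub>G\<^esub> inv\<^bsub>G\<^esub> cls b"
      define u where "u = inv\<^bsub>G\<^esub> cls [s] \<otimes>\<^bsub>G\<^esub> y \<otimes>\<^bsub>G\<^esub> cls [s]"
      have y: "y \<in> carrier G" using b(1) x by (simp add: y_def)
      have u: "u \<in> carrier G" using y sG by (simp add: u_def)
      have "cls (c s @ b) \<otimes>\<^bsub>G\<^esub> x \<otimes>\<^bsub>G\<^esub> inv\<^bsub>G\<^esub> cls (c s @ b) = cls (c s) \<otimes>\<^bsub>G\<^esub> y \<otimes>\<^bsub>G\<^esub> inv\<^bsub>G\<^esub> cls (c s)"
        using inv(1) x b(1) c(1)[OF inv(1)]
        by (subst (1 2) cls_append) (simp_all add: G.inv_mult_group G.m_assoc y_def)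
      \<comment> \<open>The complement is \<open>cls Z\<close> times the inverse of
        \<open>cls [s]\<close>; the factor \<open>cls Z\<close> then drops out of the conjugation by
        centrality.\<close>
      also have "\<dots> = cls Z \<otimes>\<^bsub>G\<^esub> u \<otimes>\<^bsub>G\<^esub> inv\<^bsub>G\<^esub> cls Z"
        unfolding cs u_def using sG y by (simp add: G.inv_mult_group G.m_assoc)
      also have "\<dots> = u \<otimes>\<^bsub>G\<^esub> cls Z \<otimes>\<^bsub>G\<^esub> inv\<^bsub>G\<^esub> cls Z" by (simp only: central_G[OF u])
      also have "\<dots> = u" using u sG by (simp add: G.m_assoc)
      also have "u = inv\<^bsub>G\<^esub> cls [s] \<otimes>\<^bsub>G\<^esub> (h \<otimes>\<^bsub>G\<^esub> x \<otimes>\<^bsub>G\<^esub> inv\<^bsub>G\<^esub> h) \<otimes>\<^bsub>G\<^esub> cls [s]"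
        by (simp only: u_def y_def b(2)[OF x])
      also have "\<dots> = inv\<^bsub>G\<^esub> cls [s] \<otimes>\<^bsub>G\<^esub> h \<otimes>\<^bsub>G\<^esub> x \<otimes>\<^bsub>G\<^esub> inv\<^bsub>G\<^esub> (inv\<^bsub>G\<^esub> cls [s] \<otimes>\<^bsub>G\<^esub> h)"
        using sG inv(2) x by (simp add: G.inv_mult_group G.m_assoc)
      finally show ?thesis by (rule HOL.sym)
    qed
    then show ?case using inv(1) b(1) c(1) by (intro bexI[of _ "c s @ b"]) simp_all
  qed
  then show thesis using that by blast
qed

section \<open>Positive conjugates of a power of a generator\<close>

lemma cls_replicate: "t \<in> S \<Longrightarrow> cls (replicate n t) = cls [t] [^]\<^bsub>G\<^esub> n"
proof (induction n)
  case (Suc n)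
  have "cls (replicate (Suc n) t) = cls (replicate n t @ [t])" by (simp add: replicate_append_same)
  also have "\<dots> = cls (replicate n t) \<otimes>\<^bsub>G\<^esub> cls [t]"
    using replicate_in_lists[OF Suc.prems] Suc.prems by (intro cls_append) simp_all
  finally show ?case using Suc by simp
qed (simp add: cls_Nil)

text \<open>Testing single letters suffices, since a nonempty common right divisor has a last
  letter; the embedding of positive braids turns divisibility in the group into braid
  congruence.\<close>

lemma is_right_gcd_one:
  assumes a: "a \<in> lists S" and b: "b \<in> lists S"
    and no_common: "\<And>u x y. a \<sim> x @ [u] \<Longrightarrow> b \<sim> y @ [u] \<Longrightarrow> False"
  shows "is_right_gcd S m (cls a) (cls b) \<one>\<^bsub>G\<^esub>"
  unfolding is_right_gcd_def
proof (intro conjI ballI impI)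
  show "\<one>\<^bsub>G\<^esub> \<in> artin_monoid S m" by (rule artin_monoid.one)
  show "right_divides S m \<one>\<^bsub>G\<^esub> (cls a)" "right_divides S m \<one>\<^bsub>G\<^esub> (cls b)"
    unfolding right_divides_def artin_monoid_eq using a b by (auto intro!: bexI[of _ "cls a"] bexI[of _ "cls b"])
  fix c assume "c \<in> artin_monoid S m" and div: "right_divides S m c (cls a) \<and> right_divides S m c (cls b)"
  then obtain e where e: "e \<in> lists S" "c = cls e" unfolding artin_monoid_eq by blast
  from div obtain d1 d2 where d: "d1 \<in> lists S" "cls a = cls d1 \<otimes>\<^bsub>G\<^esub> cls e"
      "d2 \<in> lists S" "cls b = cls d2 \<otimes>\<^bsub>G\<^esub> cls e"
    unfolding right_divides_def artin_monoid_eq e(2) by blast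
  have 1: "a \<sim> d1 @ e" "b \<sim> d2 @ e"
    using cls_eq_iff[OF a, of "d1 @ e"] cls_eq_iff[OF b, of "d2 @ e"] d
      cls_append[OF d(1) e(1)] cls_append[OF d(3) e(1)] by simp_all
  have "e = []"
  proof (rule ccontr)
    assume "e \<noteq> []"
    then obtain e' u where "e = e' @ [u]" using rev_exhaust by blast
    then show False using no_common[of "d1 @ e'" u "d2 @ e'"] 1 by simp
  qed
  then have "c = \<one>\<^bsub>G\<^esub>" using e cls_Nil by simp
  then show "right_divides S m c \<one>\<^bsub>G\<^esub>"
    unfolding right_divides_def using artin_monoid.one[of S m] by (intro bexI[of _ "\<one>\<^bsub>G\<^esub>"]) simp_all
qed

text \<open>Descent on the length of the conjugator: each common last letter of the two words allows
  a nonempty factor \<open>X\<close> to be moved through the power, possibly changing its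
  base.\<close>

lemma positive_conjugate:
  fixes n :: nat
  assumes "w \<in> lists S" "t \<in> S"
  shows "\<exists>v\<in>lists S. \<exists>s\<in>S.
    cls w \<otimes>\<^bsub>G\<^esub> (cls [t] [^]\<^bsub>G\<^esub> n) \<otimes>\<^bsub>G\<^esub> inv\<^bsub>G\<^esub> cls w = cls v \<otimes>\<^bsub>G\<^esub> (cls [s] [^]\<^bsub>G\<^esub> n) \<otimes>\<^bsub>G\<^esub> inv\<^bsub>G\<^esub> cls v \<and>
    is_right_gcd S m (cls v \<otimes>\<^bsub>G\<^esub> (cls [s] [^]\<^bsub>G\<^esub> n)) (cls v) \<one>\<^bsub>G\<^esub>"
  using assms
proof (induction "length w" arbitrary: w t rule: less_induct)
  case less
  have w: "w \<in> lists S" and t: "t \<in> S" using less.prems by simp_all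
  have power: "cls v \<otimes>\<^bsub>G\<^esub> (cls [s] [^]\<^bsub>G\<^esub> n) = cls (v @ replicate n s)" if "v \<in> lists S" "s \<in> S" for v s
    using that replicate_in_lists[of s n] by (simp only: cls_append cls_replicate)
  have wr: "w @ replicate n t \<in> lists S" using w replicate_in_lists[OF t, of n] by simp
  show ?case
  proof (cases "\<exists>u x y. w @ replicate n t \<sim> x @ [u] \<and> w \<sim> y @ [u]")
    case False
    then have "is_right_gcd S m (cls (w @ replicate n t)) (cls w) \<one>\<^bsub>G\<^esub>"
      by (intro is_right_gcd_one[OF wr w]) blast
    then show ?thesis using w t power by auto
  next
    case True
    then obtain u x y where uxy: "w @ replicate n t \<sim> x @ [u]" "w \<sim> y @ [u]" by blast
    obtain e X r where X: "w \<sim> e @ X" "X \<noteq> []" "r \<in> S" "X @ replicate n t \<sim> replicate n r @ X"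
    proof (cases "n = 0")
      case True
      \<comment> \<open>For exponent zero both words are \<open>w\<close>, and the common last
        letter itself can be removed.\<close>
      show thesis by (rule that[of y "[u]" t]) (use uxy(2) t True in simp_all)
    next
      case False
      from conjugator_reduction[OF w t this uxy]
      obtain e X r where "w \<sim> e @ X" "X \<noteq> []" "r \<in> S" "X @ [t] \<sim> r # X" .
      with shift_power that show thesis by blast
    qed
    have S: "e \<in> lists S" "X \<in> lists S" using braid_eq_lists[OF X(1)] w by simp_all
    have reps: "replicate n t \<in> lists S" "replicate n r \<in> lists S"
      using replicate_in_lists t X(3) by simp_all
    have G: "cls e \<in> carrier G" "cls X \<in> carrier G" "cls [t] [^]\<^bsub>G\<^esub> n \<in> carrier G" "cls [r] [^]\<^bsub>G\<^esub> n \<in> carrier G"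
      using S t X(3) by simp_all
    have cw: "cls w = cls e \<otimes>\<^bsub>G\<^esub> cls X"
      using X(1) cls_eq_iff[OF w, of "e @ X"] cls_append[OF S] by simp
    have XS: "X @ replicate n t \<in> lists S" using S(2) reps(1) by simp
    have cX: "cls X \<otimes>\<^bsub>G\<^esub> (cls [t] [^]\<^bsub>G\<^esub> n) = (cls [r] [^]\<^bsub>G\<^esub> n) \<otimes>\<^bsub>G\<^esub> cls X"
      using X(4) cls_eq_iff[OF XS, of "replicate n r @ X"] cls_append[OF S(2) reps(1)] cls_append[OF reps(2) S(2)]
        cls_replicate t X(3) by simp
    have "cls w \<otimes>\<^bsub>G\<^esub> (cls [t] [^]\<^bsub>G\<^esub> n) \<otimes>\<^bsub>G\<^esub> inv\<^bsub>G\<^esub> cls w =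
        cls e \<otimes>\<^bsub>G\<^esub> (cls X \<otimes>\<^bsub>G\<^esub> (cls [t] [^]\<^bsub>G\<^esub> n)) \<otimes>\<^bsub>G\<^esub> (inv\<^bsub>G\<^esub> cls X \<otimes>\<^bsub>G\<^esub> inv\<^bsub>G\<^esub> cls e)"
      unfolding cw using G by (simp add: G.m_assoc G.inv_mult_group)
    also have "\<dots> = cls e \<otimes>\<^bsub>G\<^esub> (cls [r] [^]\<^bsub>G\<^esub> n) \<otimes>\<^bsub>G\<^esub> (cls X \<otimes>\<^bsub>G\<^esub> (inv\<^bsub>G\<^esub> cls X \<otimes>\<^bsub>G\<^esub> inv\<^bsub>G\<^esub> cls e))"
      unfolding cX using G by (simp add: G.m_assoc)
    also have "cls X \<otimes>\<^bsub>G\<^esub> (inv\<^bsub>G\<^esub> cls X \<otimes>\<^bsub>G\<^esub> inv\<^bsub>G\<^esub> cls e) = inv\<^bsub>G\<^esub> cls e"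
      using G by (simp add: G.m_assoc[symmetric])
    finally have conj: "cls w \<otimes>\<^bsub>G\<^esub> (cls [t] [^]\<^bsub>G\<^esub> n) \<otimes>\<^bsub>G\<^esub> inv\<^bsub>G\<^esub> cls w =
        cls e \<otimes>\<^bsub>G\<^esub> (cls [r] [^]\<^bsub>G\<^esub> n) \<otimes>\<^bsub>G\<^esub> inv\<^bsub>G\<^esub> cls e" .
    have "length e < length w" using braid_eq_length[OF X(1)] X(2) by simp
    from less.hyps[OF this S(1) X(3)] show ?thesis unfolding conj .
  qed
qed

lemma is_right_gcd_commute: "is_right_gcd S m a b d \<longleftrightarrow> is_right_gcd S m b a d"
  unfolding is_right_gcd_def by blast

theorem ex_orthogonal_splitting:
  fixes k :: int
  assumes g: "g \<in> carrier G" and t: "t \<in> S"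
    and \<beta>: "\<beta> = g \<otimes>\<^bsub>G\<^esub> (artin_gen S m t [^]\<^bsub>G\<^esub> k) \<otimes>\<^bsub>G\<^esub> inv\<^bsub>G\<^esub> g"
  shows "\<exists>b\<in>artin_monoid S m. \<exists>s\<in>S. \<exists>j::int.
    (0 \<le> j \<longrightarrow> orthogonal_splitting S m \<beta> (b \<otimes>\<^bsub>G\<^esub> (artin_gen S m s [^]\<^bsub>G\<^esub> j), b)) \<and>
    (j < 0 \<longrightarrow> orthogonal_splitting S m \<beta> (b, b \<otimes>\<^bsub>G\<^esub> (artin_gen S m s [^]\<^bsub>G\<^esub> (- j))))"
proof -
  \<comment> \<open>The descent is done for the exponent \<bar>k\<bar>; a negative power is treated
    by inverting the result.\<close>
  define n where "n = nat \<bar>k\<bar>"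
  obtain w where w: "w \<in> lists S"
    "\<And>x. x \<in> carrier G \<Longrightarrow> g \<otimes>\<^bsub>G\<^esub> x \<otimes>\<^bsub>G\<^esub> inv\<^bsub>G\<^esub> g = cls w \<otimes>\<^bsub>G\<^esub> x \<otimes>\<^bsub>G\<^esub> inv\<^bsub>G\<^esub> cls w"
    using conj_by_positive[OF g] by blast
  have tG: "cls [t] \<in> carrier G" using t by simp
  have \<beta>w: "\<beta> = cls w \<otimes>\<^bsub>G\<^esub> (cls [t] [^]\<^bsub>G\<^esub> k) \<otimes>\<^bsub>G\<^esub> inv\<^bsub>G\<^esub> cls w"
    unfolding \<beta> artin_gen_eq using w(2) tG by simp
  obtain v s where v: "v \<in> lists S" and s: "s \<in> S"
    and conj: "cls w \<otimes>\<^bsub>G\<^esub> (cls [t] [^]\<^bsub>G\<^esub> n) \<otimes>\<^bsub>G\<^esub> inv\<^bsub>G\<^esub> cls w = cls v \<otimes>\<^bsub>G\<^esub> (cls [s] [^]\<^bsub>G\<^esub> n) \<otimes>\<^bsub>G\<^esub> inv\<^bsub>G\<^esub> cls v"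
    and gcd: "is_right_gcd S m (cls v \<otimes>\<^bsub>G\<^esub> (cls [s] [^]\<^bsub>G\<^esub> n)) (cls v) \<one>\<^bsub>G\<^esub>"
    using positive_conjugate[OF w(1) t, of n] by blast
  have G: "cls v \<in> carrier G" "cls [s] [^]\<^bsub>G\<^esub> n \<in> carrier G" "cls w \<in> carrier G" "cls [t] [^]\<^bsub>G\<^esub> n \<in> carrier G"
    using v s w(1) t by simp_all
  have vM: "cls v \<in> artin_monoid S m" using v artin_monoid_eq by blast
  have "cls (v @ replicate n s) \<in> artin_monoid S m"
    using v replicate_in_lists[OF s, of n] unfolding artin_monoid_eq by (intro imageI) simp
  then have vsM: "cls v \<otimes>\<^bsub>G\<^esub> (cls [s] [^]\<^bsub>G\<^esub> n) \<in> artin_monoid S m"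
    using cls_append[OF v replicate_in_lists[OF s]] cls_replicate[OF s] by simp
  show ?thesis
  proof (cases "0 \<le> k")
    case True
    then have k: "k = int n" by (simp add: n_def)
    have "\<beta> = cls v \<otimes>\<^bsub>G\<^esub> (cls [s] [^]\<^bsub>G\<^esub> n) \<otimes>\<^bsub>G\<^esub> inv\<^bsub>G\<^esub> cls v"
      unfolding \<beta>w k int_pow_int by (rule conj)
    then have "orthogonal_splitting S m \<beta> (cls v \<otimes>\<^bsub>G\<^esub> (artin_gen S m s [^]\<^bsub>G\<^esub> int n), cls v)"
      unfolding orthogonal_splitting_def artin_gen_eq int_pow_int using vM vsM gcd by simp
    then show ?thesis using vM s by (intro bexI[of _ "cls v"] bexI[of _ s] exI[of _ "int n"]) simp_all
  next
    case False
    then have k: "k = - int n" "n \<noteq> 0" by (simp_all add: n_def)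
    \<comment> \<open>Inversion exchanges numerator and denominator of the positive splitting, and
      the gcd condition is symmetric.\<close>
    have "\<beta> = inv\<^bsub>G\<^esub> (cls w \<otimes>\<^bsub>G\<^esub> (cls [t] [^]\<^bsub>G\<^esub> n) \<otimes>\<^bsub>G\<^esub> inv\<^bsub>G\<^esub> cls w)"
      unfolding \<beta>w k(1) G.int_pow_neg[OF tG] int_pow_int
      using G by (simp add: G.inv_mult_group G.m_assoc)
    also have "\<dots> = cls v \<otimes>\<^bsub>G\<^esub> inv\<^bsub>G\<^esub> (cls v \<otimes>\<^bsub>G\<^esub> (cls [s] [^]\<^bsub>G\<^esub> n))"
      unfolding conj using G by (simp add: G.inv_mult_group G.m_assoc)
    finally have "orthogonal_splitting S m \<beta> (cls v, cls v \<otimes>\<^bsub>G\<^esub> (artin_gen S m s [^]\<^bsub>G\<^esub> int n))"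
      unfolding orthogonal_splitting_def artin_gen_eq int_pow_int
      using vM vsM gcd is_right_gcd_commute by simp
    then show ?thesis
      \<comment> \<open>As \<open>n\<close> is not zero, the exponent \<open>- int n\<close> is
        strictly negative and selects the second form of the splitting.\<close>
      using vM s k(2) by (intro bexI[of _ "cls v"] bexI[of _ s] exI[of _ "- int n"]) simp_all
  qed
qed

end

theorem theorem1p1:
  fixes S :: "'a set" and m :: "'a \<Rightarrow> 'a \<Rightarrow> enat"
    and \<beta> :: "('a \<times> bool) list set"
  assumes "coxeter_matrix S m"
    and "spherical_type S m"
    and "\<beta> \<in> carrier (artin_group S m)"
    and "\<exists>g\<in>carrier (artin_group S m). \<exists>t\<in>S. \<exists>k::int.
      \<beta> = g \<otimes>\<^bsub>artin_group S m\<^esub> (artin_gen S m t [^]\<^bsub>artin_group S m\<^esub> k)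
            \<otimes>\<^bsub>artin_group S m\<^esub> inv\<^bsub>artin_group S m\<^esub> g"
  shows "\<exists>b\<in>artin_monoid S m. \<exists>s\<in>S. \<exists>j::int.
    (0 \<le> j \<longrightarrow> orthogonal_splitting S m \<beta>
       (b \<otimes>\<^bsub>artin_group S m\<^esub> (artin_gen S m s [^]\<^bsub>artin_group S m\<^esub> j), b)) \<and>
    (j < 0 \<longrightarrow> orthogonal_splitting S m \<beta>
       (b, b \<otimes>\<^bsub>artin_group S m\<^esub> (artin_gen S m s [^]\<^bsub>artin_group S m\<^esub> (- j))))"
proof -
  interpret spherical_coxeter_system S m
    by unfold_locales (rule assms(1,2))+
  from assms(4) ex_orthogonal_splitting show ?thesis by blast
qed

end
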